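(* Let $K$ be a commutative ring with $\mathbb Q\subset K$, let $\mathfrak g$ be a Lie $K$-algebra, and let $n\ge 1$. Suppose that the $K$-submodule $W\subset\bigotimes^n\mathfrak g$ is closed under the action of the symmetric group $\Sigma_n$ permuting the order of the tensor factors. Also assume that $\boldsymbol m|_W:W\to\mathcal U\mathfrak g$ is injective. If \[P=\sum_\lambda a_{1,\lambda}\otimes\cdots\otimes a_{n,\lambda}\] is such that $P\in W$ and $\boldsymbol m(P)\in\mathfrak g$, then \[n(n-1)\cdot\boldsymbol m(P)=\sum_\lambda\sum_{p=1}^{n-1}\bigl[[a_{1,\lambda},\ldots,a_{p,\lambda}]_{\mathrm L},\,[a_{p+1,\lambda},\ldots,a_{n,\lambda}]_{\mathrm R}\bigr].\]
   Context: $\mathcal U\mathfrak g$ is the universal enveloping algebra of $\mathfrak g$, and $\boldsymbol m:\bigotimes\mathfrak g\to\mathcal U\mathfrak g$ is the canonical algebra homomorphism from the tensor algebra, $x_1\otimes\cdots\otimes x_n\mapsto x_1\cdots x_n$; $\bigotimes^n\mathfrak g$ is the $n$-fold tensor power over $K$. Since $\mathbb Q\subset K$, the (symmetric) Poincaré–Birkhoff–Witt theorem holds, so $\mathfrak g$ is regarded as a subset of $\mathcal U\mathfrak g$. Iterated commutators: $[Y_1,\ldots,Y_p]_{\mathrm L}=[Y_1,[Y_2,\ldots,[Y_{p-1},Y_p]\ldots]]$ and $[Y_1,\ldots,Y_p]_{\mathrm R}=[[\ldots[Y_1,Y_2],\ldots,Y_{p-1}],Y_p]$, with $[Y_1]_{\mathrm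 L}=[Y_1]_{\mathrm R}=Y_1$. *)

theory Defs
  imports
    "HOL-Algebra.Algebra"
    "HOL-Library.Poly_Mapping"
    "HOL-Combinatorics.Permutations"
begin

section \<open>Lie algebras and iterated commutators\<close>

text \<open>The base ring \<open>K\<close> and the underlying abelian group of the Lie algebra are types, while
  scalar multiplication and bracket are explicit parameters; all constructions below depend on them.\<close>

definition contains_rat :: "'k::comm_ring_1 itself \<Rightarrow> bool" where
  "contains_rat _ \<longleftrightarrow> (\<exists>q :: rat \<Rightarrow> 'k. inj q \<and> q 1 = 1 \<and>
     (\<forall>x y. q (x + y) = q x + q y) \<and> (\<forall>x y. q (x * y) = q x * q y))"

locale lie_algebra = Modules.module scale
  for scale :: "'k::comm_ring_1 \<Rightarrow> 'g::ab_group_add \<Rightarrow> 'g" +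
  fixes bracket :: "'g \<Rightarrow> 'g \<Rightarrow> 'g"
  assumes bracket_add_left: "bracket (x + y) z = bracket x z + bracket y z"
    and bracket_add_right: "bracket x (y + z) = bracket x y + bracket x z"
    and bracket_scale_left: "bracket (scale c x) y = scale c (bracket x y)"
    and bracket_scale_right: "bracket x (scale c y) = scale c (bracket x y)"
    and bracket_self: "bracket x x = 0"
    and jacobi: "bracket x (bracket y z) + bracket y (bracket z x) + bracket z (bracket x y) = 0"

text \<open>The values at the empty list are irrelevant conventions.\<close>

fun commutator_L :: "('g::zero \<Rightarrow> 'g \<Rightarrow> 'g) \<Rightarrow> 'g list \<Rightarrow> 'g" where
  "commutator_L br [] = 0"
| "commutator_L br [x] = x"
| "commutator_L br (x # y # ys) = br x (commutator_L br (y # ys))"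

fun commutator_R :: "('g::zero \<Rightarrow> 'g \<Rightarrow> 'g) \<Rightarrow> 'g list \<Rightarrow> 'g" where
  "commutator_R br [] = 0"
| "commutator_R br (x # xs) = foldl br x xs"


section \<open>The free associative algebra on a type\<close>

text \<open>Words under concatenation are written additively, so that finitely supported functions on
  them carry the convolution product of \<^theory>\<open>HOL-Library.Poly_Mapping\<close>.\<close>

datatype 'a free_monoid = Word (letters: "'a list")

instantiation free_monoid :: (type) monoid_add
begin

definition zero_free_monoid :: "'a free_monoid" where
  "0 = Word []"

definition plus_free_monoid :: "'a free_monoid \<Rightarrow> 'a free_monoid \<Rightarrow> 'a free_monoid" where
  "v + w = Word (letters v @ letters w)"

instance
  by standard (simp_all add: zero_free_monoid_def plus_free_monoid_def)

end

definition word :: "'g list \<Rightarrow> ('g free_monoid \<Rightarrow>\<^sub>0 'k::comm_ring_1)" where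
  "word xs = Poly_Mapping.single (Word xs) 1"

definition fa_scale :: "'k::comm_ring_1 \<Rightarrow> ('g free_monoid \<Rightarrow>\<^sub>0 'k) \<Rightarrow> ('g free_monoid \<Rightarrow>\<^sub>0 'k)" where
  "fa_scale c f = Poly_Mapping.map ((*) c) f"

definition free_algebra :: "('k::comm_ring_1, 'g free_monoid \<Rightarrow>\<^sub>0 'k) module" where
  "free_algebra = \<lparr>carrier = UNIV, monoid.mult = (*), one = 1, ring.zero = 0, add = (+), smult = fa_scale\<rparr>"

definition scalar_ring :: "'k::comm_ring_1 ring" where
  "scalar_ring = \<lparr>carrier = UNIV, monoid.mult = (*), one = 1, ring.zero = 0, add = (+)\<rparr>"

definition quotient_algebra :: "('k, 'a) module \<Rightarrow> 'a set \<Rightarrow> ('k, 'a set) module" where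
  "quotient_algebra M I =
     \<lparr>carrier = carrier (M Quot I), monoid.mult = monoid.mult (M Quot I), one = one (M Quot I),
      ring.zero = ring.zero (M Quot I), add = add (M Quot I),
      smult = (\<lambda>c A. \<Union>a\<in>A. I +>\<^bsub>M\<^esub> (c \<odot>\<^bsub>M\<^esub> a))\<rparr>"


section \<open>Tensor algebra and tensor powers\<close>

text \<open>The direct sum over all \<open>n\<close> of the \<open>n\<close>-fold tensor powers, each of them being the free module
  on \<open>n\<close>-tuples modulo the relations of multilinearity.  The relations are homogeneous in the
  length of words, so the sum over \<open>n\<close> can be taken before passing to the quotient.\<close>

definition multilinear_relations ::
    "('k::comm_ring_1 \<Rightarrow> 'g::ab_group_add \<Rightarrow> 'g) \<Rightarrow> ('g free_monoid \<Rightarrow>\<^sub>0 'k) set" where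
  "multilinear_relations scale =
     {word (u @ [x + y] @ v) - word (u @ [x] @ v) - word (u @ [y] @ v) | u x y v. True} \<union>
     {word (u @ [scale c x] @ v) - fa_scale c (word (u @ [x] @ v)) | u c x v. True}"

definition tensor_null ::
    "('k::comm_ring_1 \<Rightarrow> 'g::ab_group_add \<Rightarrow> 'g) \<Rightarrow> ('g free_monoid \<Rightarrow>\<^sub>0 'k) set" where
  "tensor_null scale = Modules.module.span fa_scale (multilinear_relations scale)"

definition tensor_algebra ::
    "('k::comm_ring_1 \<Rightarrow> 'g::ab_group_add \<Rightarrow> 'g) \<Rightarrow> ('k, ('g free_monoid \<Rightarrow>\<^sub>0 'k) set) module" where
  "tensor_algebra scale = quotient_algebra free_algebra (tensor_null scale)"

definition pure_tensor ::
    "('k::comm_ring_1 \<Rightarrow> 'g::ab_group_add \<Rightarrow> 'g) \<Rightarrow> 'g list \<Rightarrow> ('g free_monoid \<Rightarrow>\<^sub>0 'k) set" where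
  "pure_tensor scale xs = tensor_null scale +>\<^bsub>free_algebra\<^esub> word xs"

definition tensor_power ::
    "('k::comm_ring_1 \<Rightarrow> 'g::ab_group_add \<Rightarrow> 'g) \<Rightarrow> nat \<Rightarrow> ('g free_monoid \<Rightarrow>\<^sub>0 'k) set set" where
  "tensor_power scale n =
     {tensor_null scale +>\<^bsub>free_algebra\<^esub> f | f. \<forall>w \<in> Poly_Mapping.keys f. length (letters w) = n}"

text \<open>Permutation of the factors of the \<open>n\<close>-th tensor power, extended by the identity to the other
  degrees.  It is the place permutation
  \<open>x\<^sub>1 \<otimes> \<dots> \<otimes> x\<^sub>n \<mapsto> x\<^bsub>\<sigma>(1)\<^esub> \<otimes> \<dots> \<otimes> x\<^bsub>\<sigma>(n)\<^esub>\<close>, i.e. the action of the inverse of \<open>\<sigma>\<close> under the convention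
  of left actions; closure under all permutations does not depend on this choice.\<close>

definition permute_word :: "nat \<Rightarrow> (nat \<Rightarrow> nat) \<Rightarrow> 'g free_monoid \<Rightarrow> 'g free_monoid" where
  "permute_word n \<sigma> w =
     (if length (letters w) = n then Word (permute_list \<sigma> (letters w)) else w)"

definition fa_permute ::
    "nat \<Rightarrow> (nat \<Rightarrow> nat) \<Rightarrow> ('g free_monoid \<Rightarrow>\<^sub>0 'k::comm_ring_1) \<Rightarrow> ('g free_monoid \<Rightarrow>\<^sub>0 'k)" where
  "fa_permute n \<sigma> f =
     (\<Sum>w\<in>Poly_Mapping.keys f. Poly_Mapping.single (permute_word n \<sigma> w) (Poly_Mapping.lookup f w))"

definition tensor_permute ::
    "('k::comm_ring_1 \<Rightarrow> 'g::ab_group_add \<Rightarrow> 'g) \<Rightarrow> nat \<Rightarrow> (nat \<Rightarrow> nat) \<Rightarrow>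
     ('g free_monoid \<Rightarrow>\<^sub>0 'k) set \<Rightarrow> ('g free_monoid \<Rightarrow>\<^sub>0 'k) set" where
  "tensor_permute scale n \<sigma> A = (\<Union>f\<in>A. tensor_null scale +>\<^bsub>free_algebra\<^esub> fa_permute n \<sigma> f)"


section \<open>Universal enveloping algebra\<close>

definition enveloping_ideal ::
    "('k::comm_ring_1 \<Rightarrow> 'g::ab_group_add \<Rightarrow> 'g) \<Rightarrow> ('g \<Rightarrow> 'g \<Rightarrow> 'g) \<Rightarrow>
     ('g free_monoid \<Rightarrow>\<^sub>0 'k) set set" where
  "enveloping_ideal scale bracket =
     (let T = tensor_algebra scale; t = (\<lambda>x. pure_tensor scale [x]) in
      Idl\<^bsub>T\<^esub> {t x \<otimes>\<^bsub>T\<^esub> t y \<ominus>\<^bsub>T\<^esub> t y \<otimes>\<^bsub>T\<^esub> t x \<ominus>\<^bsub>T\<^esub> t (bracket x y) | x y. True})"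

definition enveloping_algebra ::
    "('k::comm_ring_1 \<Rightarrow> 'g::ab_group_add \<Rightarrow> 'g) \<Rightarrow> ('g \<Rightarrow> 'g \<Rightarrow> 'g) \<Rightarrow>
     ('k, ('g free_monoid \<Rightarrow>\<^sub>0 'k) set set) module" where
  "enveloping_algebra scale bracket =
     quotient_algebra (tensor_algebra scale) (enveloping_ideal scale bracket)"

text \<open>The canonical homomorphism \<open>m\<close> from the tensor algebra to the enveloping algebra, and the
  canonical map of the Lie algebra into its enveloping algebra; the latter is injective, by
  Poincare-Birkhoff-Witt, if \<open>K\<close> contains the rationals.\<close>

definition env_proj ::
    "('k::comm_ring_1 \<Rightarrow> 'g::ab_group_add \<Rightarrow> 'g) \<Rightarrow> ('g \<Rightarrow> 'g \<Rightarrow> 'g) \<Rightarrow>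
     ('g free_monoid \<Rightarrow>\<^sub>0 'k) set \<Rightarrow> ('g free_monoid \<Rightarrow>\<^sub>0 'k) set set" where
  "env_proj scale bracket A = enveloping_ideal scale bracket +>\<^bsub>tensor_algebra scale\<^esub> A"

definition env_incl ::
    "('k::comm_ring_1 \<Rightarrow> 'g::ab_group_add \<Rightarrow> 'g) \<Rightarrow> ('g \<Rightarrow> 'g \<Rightarrow> 'g) \<Rightarrow>
     'g \<Rightarrow> ('g free_monoid \<Rightarrow>\<^sub>0 'k) set set" where
  "env_incl scale bracket x = env_proj scale bracket (pure_tensor scale [x])"


section \<open>Well-definedness of the constructions\<close>

lemma fa_scale_conv: "fa_scale c f = Poly_Mapping.single 0 c * f"
  by (simp add: fa_scale_def mult_map_scale_conv_mult)

lemma lookup_fa_scale: "Poly_Mapping.lookup (fa_scale c f) w = c * Poly_Mapping.lookup f w"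
  unfolding fa_scale_def by transfer (simp add: when_def)

lemma fa_module: "Modules.module (fa_scale :: 'k::comm_ring_1 \<Rightarrow> ('g free_monoid \<Rightarrow>\<^sub>0 'k) \<Rightarrow> _)"
  by unfold_locales
    (auto intro!: poly_mapping_eqI simp: lookup_fa_scale lookup_add algebra_simps)

lemma fa_scale_mult_left: "fa_scale c f * g = fa_scale c (f * g)"
  by (simp add: fa_scale_conv mult.assoc)

lemma fa_sum_singles:
  "f = (\<Sum>w\<in>Poly_Mapping.keys f. Poly_Mapping.single w (Poly_Mapping.lookup f w))"
  by (rule poly_mapping_eqI)
    (simp add: lookup_sum lookup_single when_def in_keys_iff sum.delta)

lemma single_0_central: "f * Poly_Mapping.single 0 c = Poly_Mapping.single 0 c * f"
  for f :: "'g free_monoid \<Rightarrow>\<^sub>0 'k::comm_ring_1"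
  by (subst (1 2) fa_sum_singles)
    (simp add: sum_distrib_left sum_distrib_right mult_single mult.commute)

lemma fa_scale_mult_right: "f * fa_scale c g = fa_scale c (f * g)"
  by (metis fa_scale_conv mult.assoc single_0_central)

lemma word_append: "word (xs @ ys) = word xs * word ys"
  by (simp add: word_def mult_single plus_free_monoid_def)

lemma single_conv_word: "Poly_Mapping.single w c = fa_scale c (word (letters w))"
  by (simp add: fa_scale_def word_def)

lemma free_algebra_simps [simp]:
  "carrier free_algebra = UNIV" "monoid.mult free_algebra = (*)" "one free_algebra = 1"
  "ring.zero free_algebra = 0" "add free_algebra = (+)" "smult free_algebra = fa_scale"
  by (simp_all add: free_algebra_def)

lemma scalar_ring_simps [simp]:
  "carrier scalar_ring = UNIV" "monoid.mult scalar_ring = (*)" "one scalar_ring = 1"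
  "ring.zero scalar_ring = 0" "add scalar_ring = (+)"
  by (simp_all add: scalar_ring_def)

lemma quotient_algebra_simps [simp]:
  "carrier (quotient_algebra M I) = carrier (M Quot I)"
  "monoid.mult (quotient_algebra M I) = monoid.mult (M Quot I)"
  "one (quotient_algebra M I) = one (M Quot I)"
  "ring.zero (quotient_algebra M I) = ring.zero (M Quot I)"
  "add (quotient_algebra M I) = add (M Quot I)"
  "smult (quotient_algebra M I) = (\<lambda>c A. \<Union>a\<in>A. I +>\<^bsub>M\<^esub> (c \<odot>\<^bsub>M\<^esub> a))"
  by (simp_all add: quotient_algebra_def)

lemma ring_free_algebra: "ring free_algebra"
proof (rule ringI)
  show "abelian_group (free_algebra :: ('k::comm_ring_1, 'g free_monoid \<Rightarrow>\<^sub>0 'k) module)"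
    by (rule abelian_groupI) (auto simp: add.assoc add.commute intro: exI[of _ "- x" for x] )
  show "Group.monoid (free_algebra :: ('k::comm_ring_1, 'g free_monoid \<Rightarrow>\<^sub>0 'k) module)"
    by (rule monoidI) (auto simp: mult.assoc)
qed (auto simp: algebra_simps)

lemma cring_scalar_ring: "cring scalar_ring"
proof (rule cringI)
  show "abelian_group (scalar_ring :: 'k::comm_ring_1 ring)"
    by (rule abelian_groupI) (auto simp: add.assoc add.commute intro: exI[of _ "- x" for x] )
  show "comm_monoid (scalar_ring :: 'k::comm_ring_1 ring)"
    by (rule comm_monoidI) (auto simp: mult.assoc mult.commute)
qed (auto simp: algebra_simps)


lemma coset_free_algebra: "N +>\<^bsub>free_algebra\<^esub> f = (\<lambda>h. h + f) ` N"
  by (auto simp: a_r_coset_def r_coset_def)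

lemma tensor_null_closed:
  shows "0 \<in> tensor_null scale"
    and "f \<in> tensor_null scale \<Longrightarrow> g \<in> tensor_null scale \<Longrightarrow> f + g \<in> tensor_null scale"
    and "f \<in> tensor_null scale \<Longrightarrow> g \<in> tensor_null scale \<Longrightarrow> f - g \<in> tensor_null scale"
    and "f \<in> tensor_null scale \<Longrightarrow> - f \<in> tensor_null scale"
    and "f \<in> tensor_null scale \<Longrightarrow> fa_scale c f \<in> tensor_null scale"
    and "r \<in> multilinear_relations scale \<Longrightarrow> r \<in> tensor_null scale"
    and "(\<And>i. i \<in> A \<Longrightarrow> h i \<in> tensor_null scale) \<Longrightarrow> sum h A \<in> tensor_null scale"
  unfolding tensor_null_def
  by (simp_all add: Modules.module.span_zero[OF fa_module] Modules.module.span_add[OF fa_module]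
      Modules.module.span_diff[OF fa_module] Modules.module.span_neg[OF fa_module]
      Modules.module.span_scale[OF fa_module] Modules.module.span_base[OF fa_module]
      Modules.module.span_sum[OF fa_module])

lemma tensor_null_induct [consumes 1, case_names zero add]:
  assumes "f \<in> tensor_null scale" "Q 0"
    and "\<And>c r g. r \<in> multilinear_relations scale \<Longrightarrow> Q g \<Longrightarrow> Q (fa_scale c r + g)"
  shows "Q f"
  using Modules.module.span_induct_alt[OF fa_module, of f "multilinear_relations scale" Q]
    assms unfolding tensor_null_def by blast

lemma word_mult_relation:
  assumes "r \<in> multilinear_relations scale"
  shows "word xs * r \<in> multilinear_relations scale" "r * word xs \<in> multilinear_relations scale"
proof -
  from assms consider
    (add) u x y v where "r = word (u @ [x + y] @ v) - word (u @ [x] @ v) - word (u @ [y] @ v)"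
  | (scale) u c x v where "r = word (u @ [scale c x] @ v) - fa_scale c (word (u @ [x] @ v))"
    unfolding multilinear_relations_def by blast
  note cases = this
  from cases show "word xs * r \<in> multilinear_relations scale"
  proof cases
    case add
    then have "word xs * r = word ((xs @ u) @ [x + y] @ v) - word ((xs @ u) @ [x] @ v)
        - word ((xs @ u) @ [y] @ v)"
      by (simp only: word_append right_diff_distrib mult.assoc)
    then show ?thesis unfolding multilinear_relations_def by blast
  next
    case scale
    then have "word xs * r = word ((xs @ u) @ [scale c x] @ v)
        - fa_scale c (word ((xs @ u) @ [x] @ v))"
      by (simp only: word_append right_diff_distrib mult.assoc fa_scale_mult_right)
    then show ?thesis unfolding multilinear_relations_def by blast
  qed
  from cases show "r * word xs \<in> multilinear_relations scale"
  proof cases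
    case add
    then have "r * word xs = word (u @ [x + y] @ (v @ xs)) - word (u @ [x] @ (v @ xs))
        - word (u @ [y] @ (v @ xs))"
      by (simp only: word_append left_diff_distrib mult.assoc)
    then show ?thesis unfolding multilinear_relations_def by blast
  next
    case scale
    then have "r * word xs = word (u @ [scale c x] @ (v @ xs))
        - fa_scale c (word (u @ [x] @ (v @ xs)))"
      by (simp only: word_append left_diff_distrib mult.assoc fa_scale_mult_left)
    then show ?thesis unfolding multilinear_relations_def by blast
  qed
qed

lemma tensor_null_mult:
  assumes "f \<in> tensor_null scale"
  shows "g * f \<in> tensor_null scale" "f * g \<in> tensor_null scale"
proof -
  have g: "g = (\<Sum>w\<in>Poly_Mapping.keys g. fa_scale (Poly_Mapping.lookup g w) (word (letters w)))"
    by (subst fa_sum_singles) (simp only: single_conv_word)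
  have left: "g * r \<in> tensor_null scale" and right: "r * g \<in> tensor_null scale"
    if r: "r \<in> multilinear_relations scale" for r
  proof -
    have "g * r = (\<Sum>w\<in>Poly_Mapping.keys g. fa_scale (Poly_Mapping.lookup g w) (word (letters w) * r))"
      by (subst g) (simp only: sum_distrib_right fa_scale_mult_left)
    also have "\<dots> \<in> tensor_null scale"
      by (intro tensor_null_closed(7) tensor_null_closed(5) tensor_null_closed(6)
          word_mult_relation(1) r)
    finally show "g * r \<in> tensor_null scale" .
    have "r * g = (\<Sum>w\<in>Poly_Mapping.keys g. fa_scale (Poly_Mapping.lookup g w) (r * word (letters w)))"
      by (subst g) (simp only: sum_distrib_left fa_scale_mult_right)
    also have "\<dots> \<in> tensor_null scale"
      by (intro tensor_null_closed(7) tensor_null_closed(5) tensor_null_closed(6)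
          word_mult_relation(2) r)
    finally show "r * g \<in> tensor_null scale" .
  qed
  show "g * f \<in> tensor_null scale"
    using assms
  proof (induction rule: tensor_null_induct)
    case zero
    show ?case by (simp add: tensor_null_closed(1))
  next
    case (add c r h)
    show ?case
      unfolding distrib_left fa_scale_mult_right
      by (intro tensor_null_closed(2) tensor_null_closed(5) left add)
  qed
  show "f * g \<in> tensor_null scale"
    using assms
  proof (induction rule: tensor_null_induct)
    case zero
    show ?case by (simp add: tensor_null_closed(1))
  next
    case (add c r h)
    show ?case
      unfolding distrib_right fa_scale_mult_left
      by (intro tensor_null_closed(2) tensor_null_closed(5) right add)
  qed
qed

lemma ideal_tensor_null:
  fixes scale :: "'k::comm_ring_1 \<Rightarrow> 'g::ab_group_add \<Rightarrow> 'g"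
  shows "ideal (tensor_null scale) free_algebra"
proof -
  let ?F = "free_algebra :: ('k, 'g free_monoid \<Rightarrow>\<^sub>0 'k) module"
  interpret F: ring ?F
    by (rule ring_free_algebra)
  have "\<ominus>\<^bsub>?F\<^esub> f = - f" for f
    using F.minus_equality[of "- f" f] by simp
  then have "subgroup (tensor_null scale) (add_monoid ?F)"
    using tensor_null_closed(1)[of scale]
    by (intro F.add.subgroupI) (auto intro: tensor_null_closed)
  then show ?thesis
    by (intro idealI[OF ring_free_algebra]) (auto intro: tensor_null_mult)
qed

lemma ring_quotient_algebra:
  assumes "ideal I M"
  shows "ring (quotient_algebra M I)"
proof -
  interpret Q: ring "M Quot I"
    by (rule ideal.quotient_is_ring[OF assms])
  show ?thesis
  proof (rule ringI)
    show "abelian_group (quotient_algebra M I)"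
      by (rule abelian_groupI) (auto simp: Q.a_ac intro: Q.l_neg)
    show "Group.monoid (quotient_algebra M I)"
      by (rule monoidI) (auto simp: Q.m_assoc)
  qed (auto simp: Q.l_distr Q.r_distr)
qed

lemma smult_quotient_algebra:
  assumes "ideal I M" "x \<in> carrier M" "c \<odot>\<^bsub>M\<^esub> x \<in> carrier M"
    and add: "\<And>y. y \<in> I \<Longrightarrow> c \<odot>\<^bsub>M\<^esub> (y \<oplus>\<^bsub>M\<^esub> x) = c \<odot>\<^bsub>M\<^esub> y \<oplus>\<^bsub>M\<^esub> c \<odot>\<^bsub>M\<^esub> x"
    and closed: "\<And>y. y \<in> I \<Longrightarrow> c \<odot>\<^bsub>M\<^esub> y \<in> I"
  shows "c \<odot>\<^bsub>quotient_algebra M I\<^esub> (I +>\<^bsub>M\<^esub> x) = I +>\<^bsub>M\<^esub> (c \<odot>\<^bsub>M\<^esub> x)"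
proof -
  interpret ideal I M by fact
  have "I +>\<^bsub>M\<^esub> (c \<odot>\<^bsub>M\<^esub> z) = I +>\<^bsub>M\<^esub> (c \<odot>\<^bsub>M\<^esub> x)" if z: "z \<in> I +>\<^bsub>M\<^esub> x" for z
  proof -
    obtain y where y: "y \<in> I" "z = y \<oplus>\<^bsub>M\<^esub> x"
      using z by (auto simp: a_r_coset_def')
    then have "c \<odot>\<^bsub>M\<^esub> z \<in> I +>\<^bsub>M\<^esub> (c \<odot>\<^bsub>M\<^esub> x)"
      using add[OF y(1)] closed[OF y(1)] by (auto simp: a_r_coset_def')
    then show ?thesis
      using a_repr_independence assms(3) a_subgroup by metis
  qed
  note eq = this
  have mem: "x \<in> I +>\<^bsub>M\<^esub> x"
    using assms(2) by (rule a_rcos_self)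
  have "(\<Union>z\<in>I +>\<^bsub>M\<^esub> x. I +>\<^bsub>M\<^esub> (c \<odot>\<^bsub>M\<^esub> z)) = I +>\<^bsub>M\<^esub> (c \<odot>\<^bsub>M\<^esub> x)"
    by (rule UN_constant_eq[OF mem]) (intro ballI, rule eq)
  then show ?thesis
    by (simp only: quotient_algebra_simps)
qed

lemma fa_permute_single:
  "fa_permute n \<sigma> (Poly_Mapping.single w c) = Poly_Mapping.single (permute_word n \<sigma> w) c"
  by (cases "c = 0") (simp_all add: fa_permute_def)

lemma fa_permute_add: "fa_permute n \<sigma> (f + g) = fa_permute n \<sigma> f + fa_permute n \<sigma> g"
proof -
  have *: "fa_permute n \<sigma> h = (\<Sum>w\<in>A. Poly_Mapping.single (permute_word n \<sigma> w) (Poly_Mapping.lookup h w))"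
    if "finite A" "Poly_Mapping.keys h \<subseteq> A" for h :: "'a free_monoid \<Rightarrow>\<^sub>0 'b" and A
    unfolding fa_permute_def using that
    by (intro sum.mono_neutral_left) (auto simp: in_keys_iff)
  let ?A = "Poly_Mapping.keys f \<union> Poly_Mapping.keys g"
  show ?thesis
    using *[of ?A "f + g"] *[of ?A f] *[of ?A g] Poly_Mapping.keys_add[of f g]
    by (simp add: lookup_add single_add sum.distrib)
qed


lemma ring_tensor_algebra: "ring (tensor_algebra scale)"
  unfolding tensor_algebra_def by (rule ring_quotient_algebra[OF ideal_tensor_null])

lemma tensor_coset_ops:
  fixes scale :: "'k::comm_ring_1 \<Rightarrow> 'g::ab_group_add \<Rightarrow> 'g"
  defines "N \<equiv> tensor_null scale"
  shows "(N +>\<^bsub>free_algebra\<^esub> f) \<oplus>\<^bsub>tensor_algebra scale\<^esub> (N +>\<^bsub>free_algebra\<^esub> g)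
      = N +>\<^bsub>free_algebra\<^esub> (f + g)"
    and "(N +>\<^bsub>free_algebra\<^esub> f) \<otimes>\<^bsub>tensor_algebra scale\<^esub> (N +>\<^bsub>free_algebra\<^esub> g)
      = N +>\<^bsub>free_algebra\<^esub> (f * g)"
    and "c \<odot>\<^bsub>tensor_algebra scale\<^esub> (N +>\<^bsub>free_algebra\<^esub> f) = N +>\<^bsub>free_algebra\<^esub> (fa_scale c f)"
    and "carrier (tensor_algebra scale) = range (\<lambda>f. N +>\<^bsub>free_algebra\<^esub> f)"
    and "N +>\<^bsub>free_algebra\<^esub> f = N +>\<^bsub>free_algebra\<^esub> g \<longleftrightarrow> f - g \<in> N"
proof -
  have I: "ideal N free_algebra"
    unfolding N_def by (rule ideal_tensor_null)
  note hom = ideal.rcos_ring_hom[OF I]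
  show "(N +>\<^bsub>free_algebra\<^esub> f) \<oplus>\<^bsub>tensor_algebra scale\<^esub> (N +>\<^bsub>free_algebra\<^esub> g)
      = N +>\<^bsub>free_algebra\<^esub> (f + g)"
    using ring_hom_add[OF hom, of f g] by (simp add: tensor_algebra_def N_def)
  show "(N +>\<^bsub>free_algebra\<^esub> f) \<otimes>\<^bsub>tensor_algebra scale\<^esub> (N +>\<^bsub>free_algebra\<^esub> g)
      = N +>\<^bsub>free_algebra\<^esub> (f * g)"
    using ring_hom_mult[OF hom, of f g] by (simp add: tensor_algebra_def N_def)
  show "c \<odot>\<^bsub>tensor_algebra scale\<^esub> (N +>\<^bsub>free_algebra\<^esub> f) = N +>\<^bsub>free_algebra\<^esub> (fa_scale c f)"
    using smult_quotient_algebra[OF I, of f c] unfolding tensor_algebra_def N_def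
    by (simp add: fa_scale_conv distrib_left tensor_null_mult del: quotient_algebra_simps)
  show "carrier (tensor_algebra scale) = range (\<lambda>f. N +>\<^bsub>free_algebra\<^esub> f)"
    by (auto simp: tensor_algebra_def FactRing_def A_RCOSETS_def RCOSETS_def a_r_coset_def N_def)
  show "N +>\<^bsub>free_algebra\<^esub> f = N +>\<^bsub>free_algebra\<^esub> g \<longleftrightarrow> f - g \<in> N"
  proof
    assume "N +>\<^bsub>free_algebra\<^esub> f = N +>\<^bsub>free_algebra\<^esub> g"
    moreover have "f \<in> N +>\<^bsub>free_algebra\<^esub> f"
      unfolding coset_free_algebra N_def using tensor_null_closed(1) by (auto intro!: image_eqI[of _ _ 0])
    ultimately obtain h where "h \<in> N" "f = h + g"
      by (auto simp: coset_free_algebra)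
    then show "f - g \<in> N" by simp
  next
    assume *: "f - g \<in> N"
    have "h + f \<in> (\<lambda>h. h + g) ` N" if "h \<in> N" for h
      using that * tensor_null_closed(2)[of h scale "f - g"] unfolding N_def
      by (intro image_eqI[of _ _ "h + (f - g)"]) auto
    moreover have "h + g \<in> (\<lambda>h. h + f) ` N" if "h \<in> N" for h
      using that * tensor_null_closed(3)[of h scale "f - g"] unfolding N_def
      by (intro image_eqI[of _ _ "h - (f - g)"]) auto
    ultimately show "N +>\<^bsub>free_algebra\<^esub> f = N +>\<^bsub>free_algebra\<^esub> g"
      unfolding coset_free_algebra by blast
  qed
qed

lemma fa_scale_laws:
  "fa_scale (b + c) f = fa_scale b f + fa_scale c f"
  "fa_scale c (f + g) = fa_scale c f + fa_scale c g"
  "fa_scale (b * c) f = fa_scale b (fa_scale c f)"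
  "fa_scale 1 f = f"
  by (auto intro!: poly_mapping_eqI simp: lookup_fa_scale lookup_add algebra_simps)

lemma module_tensor_algebra:
  "Module.module (scalar_ring :: 'k::comm_ring_1 ring) (tensor_algebra scale)"
  by (rule Module.moduleI)
    (simp_all only: cring_scalar_ring ring.is_abelian_group[OF ring_tensor_algebra]
      tensor_coset_ops(4), (elim rangeE; simp add: tensor_coset_ops(1,3) fa_scale_laws)+)

lemma pure_tensor_in_carrier: "pure_tensor scale xs \<in> carrier (tensor_algebra scale)"
  by (simp add: tensor_coset_ops(4) pure_tensor_def)

lemma pure_tensor_mult:
  "pure_tensor scale xs \<otimes>\<^bsub>tensor_algebra scale\<^esub> pure_tensor scale ys = pure_tensor scale (xs @ ys)"
  by (simp add: tensor_coset_ops(2) pure_tensor_def word_append)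

lemma pure_tensor_add:
  "pure_tensor scale (u @ [x + y] @ v) =
     pure_tensor scale (u @ [x] @ v) \<oplus>\<^bsub>tensor_algebra scale\<^esub> pure_tensor scale (u @ [y] @ v)"
proof -
  have "word (u @ [x + y] @ v) - word (u @ [x] @ v) - word (u @ [y] @ v) \<in> tensor_null scale"
    by (rule tensor_null_closed(6)) (unfold multilinear_relations_def, blast)
  then show ?thesis
    unfolding pure_tensor_def tensor_coset_ops(1,5) by (simp add: algebra_simps)
qed

lemma pure_tensor_scale:
  "pure_tensor scale (u @ [scale c x] @ v) =
     c \<odot>\<^bsub>tensor_algebra scale\<^esub> pure_tensor scale (u @ [x] @ v)"
proof -
  have "word (u @ [scale c x] @ v) - fa_scale c (word (u @ [x] @ v)) \<in> tensor_null scale"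
    by (rule tensor_null_closed(6)) (unfold multilinear_relations_def, blast)
  then show ?thesis
    unfolding pure_tensor_def tensor_coset_ops(3,5) .
qed

lemma pure_tensor_in_tensor_power: "pure_tensor scale xs \<in> tensor_power scale (length xs)"
  by (auto simp: tensor_power_def pure_tensor_def word_def)


lemma fa_permute_fa_scale: "fa_permute n \<sigma> (fa_scale c f) = fa_scale c (fa_permute n \<sigma> f)"
proof -
  have *: "fa_permute n \<sigma> h = (\<Sum>w\<in>A. Poly_Mapping.single (permute_word n \<sigma> w) (Poly_Mapping.lookup h w))"
    if "finite A" "Poly_Mapping.keys h \<subseteq> A" for h :: "'a free_monoid \<Rightarrow>\<^sub>0 'b" and A
    unfolding fa_permute_def using that
    by (intro sum.mono_neutral_left) (auto simp: in_keys_iff)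
  have "Poly_Mapping.keys (fa_scale c f) \<subseteq> Poly_Mapping.keys f"
    by (auto simp: in_keys_iff lookup_fa_scale)
  from *[OF _ this] *[OF _ order.refl, of f] show ?thesis
    by (simp add: lookup_fa_scale fa_scale_conv[of _ "sum _ _"] sum_distrib_left mult_single)
qed

lemma fa_permute_diff: "fa_permute n \<sigma> (f - g) = fa_permute n \<sigma> f - fa_permute n \<sigma> g"
  by (metis add_diff_cancel_right' diff_add_cancel fa_permute_add)

lemma permute_list_hole:
  assumes "\<sigma> permutes {..<length (u @ [x] @ v)}"
  shows "\<exists>u' v'. \<forall>y. permute_list \<sigma> (u @ [y] @ v) = u' @ [y] @ v'"
proof -
  let ?n = "length (u @ [x] @ v)"
  define k where "k = inv_into UNIV \<sigma> (length u)"
  have k: "\<sigma> k = length u" "k < ?n"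
    using assms permutes_inverses(1)[OF assms] permutes_in_image[OF permutes_inv[OF assms], of "length u"]
    by (auto simp: k_def)
  define zs where "zs = permute_list \<sigma> (u @ [x] @ v)"
  have "permute_list \<sigma> (u @ [y] @ v) = take k zs @ [y] @ drop (Suc k) zs" for y
  proof -
    have "permute_list \<sigma> (u @ [y] @ v) = zs[k := y]"
    proof (rule nth_equalityI)
      fix i assume i: "i < length (permute_list \<sigma> (u @ [y] @ v))"
      have "\<sigma> i = length u \<longleftrightarrow> i = k"
        using k permutes_inj[OF assms] by (metis injD)
      then show "permute_list \<sigma> (u @ [y] @ v) ! i = zs[k := y] ! i"
        using i k by (cases "i = k")
          (auto simp: zs_def permute_list_def nth_append nth_list_update nth_Cons' simp del: upt_Suc)
    qed (simp add: zs_def)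
    also have "\<dots> = take k zs @ [y] @ drop (Suc k) zs"
      using k by (simp add: upd_conv_take_nth_drop zs_def)
    finally show ?thesis .
  qed
  then show ?thesis by blast
qed

lemma fa_permute_word:
  "fa_permute n \<sigma> (word xs) = word (letters (permute_word n \<sigma> (Word xs)))"
  by (simp add: word_def fa_permute_single)

lemma permute_word_hole:
  assumes "\<sigma> permutes {..<n}"
  shows "\<exists>u' v'. \<forall>y. permute_word n \<sigma> (Word (u @ [y] @ v)) = Word (u' @ [y] @ v')"
proof (cases "Suc (length u + length v) = n")
  case True
  then have "\<sigma> permutes {..<length (u @ [undefined] @ v)}"
    using assms by simp
  then obtain u' v' where "\<forall>y. permute_list \<sigma> (u @ [y] @ v) = u' @ [y] @ v'"
    using permute_list_hole[of \<sigma> u undefined v] by blast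
  with True show ?thesis
    by (intro exI[of _ u'] exI[of _ v']) (simp add: permute_word_def)
next
  case False
  then show ?thesis
    by (intro exI[of _ u] exI[of _ v]) (simp add: permute_word_def)
qed

lemma fa_permute_relation:
  assumes \<sigma>: "\<sigma> permutes {..<n}" and r: "r \<in> multilinear_relations scale"
  shows "fa_permute n \<sigma> r \<in> multilinear_relations scale"
proof -
  from r consider
    (add) u x y v where "r = word (u @ [x + y] @ v) - word (u @ [x] @ v) - word (u @ [y] @ v)"
  | (scale) u c x v where "r = word (u @ [scale c x] @ v) - fa_scale c (word (u @ [x] @ v))"
    unfolding multilinear_relations_def by blast
  then show ?thesis
  proof cases
    case add
    obtain u' v' where "\<forall>z. permute_word n \<sigma> (Word (u @ [z] @ v)) = Word (u' @ [z] @ v')"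
      using permute_word_hole[OF \<sigma>, of u v] by blast
    note hole = this[rule_format]
    have "fa_permute n \<sigma> r = word (u' @ [x + y] @ v') - word (u' @ [x] @ v') - word (u' @ [y] @ v')"
      by (simp only: add fa_permute_diff fa_permute_word hole free_monoid.sel)
    then show ?thesis unfolding multilinear_relations_def by blast
  next
    case scale
    obtain u' v' where "\<forall>z. permute_word n \<sigma> (Word (u @ [z] @ v)) = Word (u' @ [z] @ v')"
      using permute_word_hole[OF \<sigma>, of u v] by blast
    note hole = this[rule_format]
    have "fa_permute n \<sigma> r = word (u' @ [scale c x] @ v') - fa_scale c (word (u' @ [x] @ v'))"
      by (simp only: scale fa_permute_diff fa_permute_fa_scale fa_permute_word hole free_monoid.sel)
    then show ?thesis unfolding multilinear_relations_def by blast
  qed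
qed

lemma fa_permute_tensor_null:
  assumes "\<sigma> permutes {..<n}" "f \<in> tensor_null scale"
  shows "fa_permute n \<sigma> f \<in> tensor_null scale"
  using assms(2)
proof (induction rule: tensor_null_induct)
  case zero
  then show ?case by (simp add: fa_permute_def tensor_null_closed)
next
  case (add c r g)
  then show ?case
    by (simp add: fa_permute_add fa_permute_fa_scale tensor_null_closed fa_permute_relation[OF assms(1)])
qed

lemma tensor_permute_coset:
  assumes "\<sigma> permutes {..<n}"
  shows "tensor_permute scale n \<sigma> (tensor_null scale +>\<^bsub>free_algebra\<^esub> f) =
     tensor_null scale +>\<^bsub>free_algebra\<^esub> fa_permute n \<sigma> f"
proof -
  have "tensor_null scale +>\<^bsub>free_algebra\<^esub> fa_permute n \<sigma> (h + f)
      = tensor_null scale +>\<^bsub>free_algebra\<^esub> fa_permute n \<sigma> f" if "h \<in> tensor_null scale" for h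
    using fa_permute_tensor_null[OF assms that] by (simp add: tensor_coset_ops(5) fa_permute_add)
  then show ?thesis
    unfolding tensor_permute_def coset_free_algebra[of _ f] using tensor_null_closed(1)[of scale]
    by auto
qed

lemma tensor_permute_pure_tensor:
  assumes "\<sigma> permutes {..<length xs}"
  shows "tensor_permute scale (length xs) \<sigma> (pure_tensor scale xs) =
    pure_tensor scale (permute_list \<sigma> xs)"
  unfolding pure_tensor_def using assms by (simp add: tensor_permute_coset fa_permute_word permute_word_def)

lemma ideal_enveloping_ideal: "ideal (enveloping_ideal scale bracket) (tensor_algebra scale)"
proof -
  interpret T: ring "tensor_algebra scale" by (rule ring_tensor_algebra)
  show ?thesis
    unfolding enveloping_ideal_def Let_def
    by (rule T.genideal_ideal) (auto intro!: T.minus_closed T.m_closed pure_tensor_in_carrier)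
qed

lemma ring_enveloping_algebra: "ring (enveloping_algebra scale bracket)"
  unfolding enveloping_algebra_def by (rule ring_quotient_algebra[OF ideal_enveloping_ideal])

lemma env_proj_ring_hom:
  "env_proj scale bracket \<in> ring_hom (tensor_algebra scale) (enveloping_algebra scale bracket)"
proof -
  have "env_proj scale bracket = (+>\<^bsub>tensor_algebra scale\<^esub>) (enveloping_ideal scale bracket)"
    by (rule ext) (simp add: env_proj_def)
  then show ?thesis
    using ideal.rcos_ring_hom[OF ideal_enveloping_ideal, of scale bracket]
    by (simp add: ring_hom_def enveloping_algebra_def)
qed

lemma env_proj_pure_tensor_Cons:
  "env_proj scale bracket (pure_tensor scale (x # xs)) =
     env_incl scale bracket x \<otimes>\<^bsub>enveloping_algebra scale bracket\<^esub> env_proj scale bracket (pure_tensor scale xs)"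
  using ring_hom_mult[OF env_proj_ring_hom pure_tensor_in_carrier pure_tensor_in_carrier, of scale bracket "[x]" xs]
  by (simp add: env_incl_def pure_tensor_mult)

lemma env_incl_bracket:
  fixes scale bracket defines "U \<equiv> enveloping_algebra scale bracket"
  shows "env_incl scale bracket (bracket x y) =
     env_incl scale bracket x \<otimes>\<^bsub>U\<^esub> env_incl scale bracket y
     \<ominus>\<^bsub>U\<^esub> env_incl scale bracket y \<otimes>\<^bsub>U\<^esub> env_incl scale bracket x"
proof -
  interpret T: ring "tensor_algebra scale" by (rule ring_tensor_algebra)
  interpret U: ring U unfolding U_def by (rule ring_enveloping_algebra)
  interpret h: ring_hom_ring "tensor_algebra scale" U "env_proj scale bracket"
    using env_proj_ring_hom[of scale bracket] by (intro ring_hom_ringI2) (auto simp: U_def T.ring_axioms U.ring_axioms[unfolded U_def])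
  let ?t = "\<lambda>x. pure_tensor scale [x]"
  let ?z = "?t x \<otimes>\<^bsub>tensor_algebra scale\<^esub> ?t y \<ominus>\<^bsub>tensor_algebra scale\<^esub> ?t y \<otimes>\<^bsub>tensor_algebra scale\<^esub> ?t x
    \<ominus>\<^bsub>tensor_algebra scale\<^esub> ?t (bracket x y)"
  interpret I: ideal "enveloping_ideal scale bracket" "tensor_algebra scale" by (rule ideal_enveloping_ideal)
  have "?z \<in> enveloping_ideal scale bracket"
    unfolding enveloping_ideal_def Let_def
    by (rule subsetD[OF T.genideal_self]) (auto intro!: T.minus_closed T.m_closed pure_tensor_in_carrier)
  then have z: "env_proj scale bracket ?z = \<zero>\<^bsub>U\<^esub>"
    using I.a_rcos_const by (simp add: env_proj_def U_def enveloping_algebra_def FactRing_def)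
  have t [simp]: "?t u \<in> carrier (tensor_algebra scale)" for u
    by (rule pure_tensor_in_carrier)
  have minus: "env_proj scale bracket (A \<ominus>\<^bsub>tensor_algebra scale\<^esub> B)
      = env_proj scale bracket A \<ominus>\<^bsub>U\<^esub> env_proj scale bracket B"
    if "A \<in> carrier (tensor_algebra scale)" "B \<in> carrier (tensor_algebra scale)" for A B
    using that by (simp add: T.minus_eq U.minus_eq)
  have "env_proj scale bracket ?z =
      (env_incl scale bracket x \<otimes>\<^bsub>U\<^esub> env_incl scale bracket y
       \<ominus>\<^bsub>U\<^esub> env_incl scale bracket y \<otimes>\<^bsub>U\<^esub> env_incl scale bracket x)
      \<ominus>\<^bsub>U\<^esub> env_incl scale bracket (bracket x y)"
    by (simp add: minus env_incl_def)
  moreover have "env_incl scale bracket u \<in> carrier U" for u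
    by (simp add: env_incl_def)
  ultimately show ?thesis
    using z by (metis U.r_right_minus_eq U.minus_closed U.m_closed)
qed

end

theory Submission
  imports Defs "HOL-Library.Product_Plus"
begin

text \<open>Write \<open>F\<close> for the free algebra on the letters of \<open>\<gg>\<close> and \<open>\<Psi>\<close> for its second Adams operation,
  the composition of the unshuffle coproduct (letters are primitive) with the multiplication.  In
  degree \<open>n\<close> it is a sum of place permutations, and it preserves every two-sided ideal generated by
  primitive elements, in particular the kernels of \<open>F \<rightarrow> \<Otimes>\<gg>\<close> and \<open>F \<rightarrow> \<U>\<gg>\<close>.  If \<open>m(P)\<close> lies in
  \<open>\<gg>\<close>, then \<open>\<Psi> P\<close> and \<open>2 P\<close> have the same image in \<open>\<U>\<gg>\<close>, and both lie in \<open>W\<close>; by injectivity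
  \<open>\<Psi> P = 2 P\<close> in \<open>\<Otimes>\<gg>\<close>.

  On products of at most \<open>j\<close> Lie monomials, \<open>\<Psi>\<close> is \<open>2 ^ j\<close> modulo products of fewer of them.  Applying
  \<open>2 ^ j - \<Psi>\<close> for \<open>j = n, \<dots>, 2\<close> to \<open>P\<close> therefore produces a combination of Lie monomials, but also a
  multiple of \<open>P\<close> by a unit.  Hence \<open>P\<close> is a combination of Lie monomials in \<open>\<Otimes>\<gg>\<close>, and for these the
  identity follows by induction, in the style of the Dynkin-Specht-Wever theorem.\<close>

section \<open>Linear maps between free modules\<close>

text \<open>The target is an arbitrary module with explicit scalar multiplication: free modules
  serve for the coproduct, the Lie algebra serves for \<open>evaluate\<close>.\<close>

definition lin_ext ::
    "('k::comm_ring_1 \<Rightarrow> 'b::ab_group_add \<Rightarrow> 'b) \<Rightarrow> ('w \<Rightarrow> 'b) \<Rightarrow> ('w \<Rightarrow>\<^sub>0 'k) \<Rightarrow> 'b" where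
  "lin_ext scale \<phi> f = (\<Sum>w\<in>Poly_Mapping.keys f. scale (Poly_Mapping.lookup f w) (\<phi> w))"

context Modules.module
begin

lemma lin_ext_superset:
  fixes f :: "'w \<Rightarrow>\<^sub>0 'a"
  assumes "finite A" "Poly_Mapping.keys f \<subseteq> A"
  shows "lin_ext scale \<phi> f = (\<Sum>w\<in>A. scale (Poly_Mapping.lookup f w) (\<phi> w))"
  unfolding lin_ext_def using assms by (intro sum.mono_neutral_left) (auto simp: in_keys_iff)

lemma lin_ext_add: "lin_ext scale \<phi> (f + g) = lin_ext scale \<phi> f + lin_ext scale \<phi> g"
proof -
  let ?A = "Poly_Mapping.keys f \<union> Poly_Mapping.keys g"
  show ?thesis
    using Poly_Mapping.keys_add[of f g]
    by (simp add: lin_ext_superset[of ?A] lookup_add scale_left_distrib sum.distrib)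
qed

lemma lin_ext_zero [simp]: "lin_ext scale \<phi> 0 = 0"
  by (simp add: lin_ext_def)

lemma lin_ext_minus: "lin_ext scale \<phi> (- f) = - lin_ext scale \<phi> f"
  using lin_ext_add[of \<phi> f "- f"] by (simp add: eq_neg_iff_add_eq_0 add.commute)

lemma lin_ext_diff: "lin_ext scale \<phi> (f - g) = lin_ext scale \<phi> f - lin_ext scale \<phi> g"
  using lin_ext_add[of \<phi> f "- g"] by (simp add: lin_ext_minus)

lemma lin_ext_sum: "lin_ext scale \<phi> (sum h S) = (\<Sum>i\<in>S. lin_ext scale \<phi> (h i))"
  by (induction S rule: infinite_finite_induct) (simp_all add: lin_ext_add)

lemma lin_ext_single [simp]: "lin_ext scale \<phi> (Poly_Mapping.single w c) = scale c (\<phi> w)"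
  by (cases "c = 0") (simp_all add: lin_ext_def)

lemma lin_ext_cong:
  "(\<And>w. w \<in> Poly_Mapping.keys f \<Longrightarrow> \<phi> w = \<psi> w) \<Longrightarrow> lin_ext scale \<phi> f = lin_ext scale \<psi> f"
  by (simp add: lin_ext_def)

lemma lin_ext_add_fun: "lin_ext scale (\<lambda>w. \<phi> w + \<psi> w) f = lin_ext scale \<phi> f + lin_ext scale \<psi> f"
  by (simp add: lin_ext_def scale_right_distrib sum.distrib)

lemma lin_ext_sum_fun: "lin_ext scale (\<lambda>w. \<Sum>i\<in>S. \<phi> i w) f = (\<Sum>i\<in>S. lin_ext scale (\<phi> i) f)"
  unfolding lin_ext_def scale_sum_right by (rule sum.swap)

lemma lin_ext_linear:
  fixes f :: "'w \<Rightarrow>\<^sub>0 'a"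
  assumes "\<And>x y. h (x + y) = h x + h y" "\<And>c x. h (scale c x) = scale c (h x)"
  shows "lin_ext scale (\<lambda>w. h (\<phi> w)) f = h (lin_ext scale \<phi> f)"
proof -
  have [simp]: "h 0 = 0" using assms(1)[of 0 0] by simp
  have "h (sum g S) = (\<Sum>i\<in>S. h (g i))" for g and S :: "'w set"
    by (induction S rule: infinite_finite_induct) (simp_all add: assms(1))
  then show ?thesis by (simp add: lin_ext_def assms(2))
qed

lemma lin_ext_swap:
  "lin_ext scale (\<lambda>u. lin_ext scale (\<lambda>v. \<phi> u v) g) f = lin_ext scale (\<lambda>v. lin_ext scale (\<lambda>u. \<phi> u v) f) g"
  unfolding lin_ext_def scale_sum_right by (subst sum.swap) (simp add: mult.commute)

lemma lin_ext_mult: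
  fixes f g :: "'w::monoid_add \<Rightarrow>\<^sub>0 'a"
  shows "lin_ext scale \<phi> (f * g) = lin_ext scale (\<lambda>u. lin_ext scale (\<lambda>v. \<phi> (u + v)) g) f"
proof -
  have eq: "h = (\<Sum>w\<in>Poly_Mapping.keys h. Poly_Mapping.single w (Poly_Mapping.lookup h w))"
    for h :: "'w \<Rightarrow>\<^sub>0 'a"
    by (rule poly_mapping_eqI) (simp add: lookup_sum lookup_single when_def in_keys_iff sum.delta)
  have "lin_ext scale \<phi> (f * g) = lin_ext scale \<phi> (\<Sum>u\<in>Poly_Mapping.keys f. \<Sum>v\<in>Poly_Mapping.keys g.
      Poly_Mapping.single (u + v) (Poly_Mapping.lookup f u * Poly_Mapping.lookup g v))"
    by (subst eq[of f], subst eq[of g]) (simp add: sum_product mult_single)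
  also have "\<dots> = lin_ext scale (\<lambda>u. lin_ext scale (\<lambda>v. \<phi> (u + v)) g) f"
    by (simp add: lin_ext_sum lin_ext_def[of _ _ f] lin_ext_def[of _ _ g] scale_sum_right)
  finally show ?thesis .
qed

end


text \<open>The body is that of \<open>fa_scale\<close>, but over any index type, because the tensor
  square used below has pairs of words as its basis.\<close>

definition pm_scale :: "'k::comm_ring_1 \<Rightarrow> ('w \<Rightarrow>\<^sub>0 'k) \<Rightarrow> ('w \<Rightarrow>\<^sub>0 'k)" where
  "pm_scale c f = Poly_Mapping.map ((*) c) f"

lemma fa_scale_eq_pm_scale: "fa_scale = pm_scale"
  by (simp add: fun_eq_iff fa_scale_def pm_scale_def)

lemma lookup_pm_scale [simp]: "Poly_Mapping.lookup (pm_scale c f) w = c * Poly_Mapping.lookup f w"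
  unfolding pm_scale_def by transfer (simp add: when_def)

interpretation pm: Modules.module pm_scale
  by unfold_locales (auto intro!: poly_mapping_eqI simp: lookup_add algebra_simps)

lemma pm_scale_single [simp]: "pm_scale c (Poly_Mapping.single w d) = Poly_Mapping.single w (c * d)"
  by (rule poly_mapping_eqI) (simp add: lookup_single when_def)

lemma pm_eq_lin_ext: "f = lin_ext pm_scale (\<lambda>w. Poly_Mapping.single w 1) f"
  by (rule poly_mapping_eqI)
    (simp add: lin_ext_def lookup_sum lookup_single when_def in_keys_iff sum.delta)

lemma pm_scale_mult_left: "pm_scale c f * g = pm_scale c (f * g)"
  for f g :: "'w::monoid_add \<Rightarrow>\<^sub>0 'k::comm_ring_1"
  by (simp add: pm_scale_def mult_map_scale_conv_mult mult.assoc)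

lemma pm_scale_mult_right: "f * pm_scale c g = pm_scale c (f * g)"
  for f g :: "'w::monoid_add \<Rightarrow>\<^sub>0 'k::comm_ring_1"
proof -
  have "f * Poly_Mapping.single 0 c = Poly_Mapping.single 0 c * f"
    by (subst (1 2) pm_eq_lin_ext[of f])
      (simp add: lin_ext_def sum_distrib_left sum_distrib_right mult_single mult.commute)
  then show ?thesis
    by (simp add: pm_scale_def mult_map_scale_conv_mult flip: mult.assoc)
qed

lemma lin_ext_pm_scale:
  assumes "Modules.module s"
  shows "lin_ext s \<phi> (pm_scale c f) = s c (lin_ext s \<phi> f)"
proof -
  interpret m: Modules.module s by fact
  have "Poly_Mapping.keys (pm_scale c f) \<subseteq> Poly_Mapping.keys f"
    by (auto simp: in_keys_iff)
  then show ?thesis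
    by (simp add: m.lin_ext_superset[of "Poly_Mapping.keys f"] m.scale_sum_right)
qed

lemmas pm_lin_ext_scale = lin_ext_pm_scale[OF pm.module_axioms]

text \<open>Agreement is tested on \<open>single w c\<close> with arbitrary coefficients, and
  additivity carries it to all finite sums.\<close>

lemma pm_linear_eqI:
  fixes F G :: "('w \<Rightarrow>\<^sub>0 'k::comm_ring_1) \<Rightarrow> 'b::ab_group_add"
  assumes "\<And>f g. F (f + g) = F f + F g" "\<And>f g. G (f + g) = G f + G g"
    and "\<And>w c. F (Poly_Mapping.single w c) = G (Poly_Mapping.single w c)"
  shows "F f = G f"
proof -
  have [simp]: "F 0 = 0" "G 0 = 0" using assms(1,2)[of 0 0] by simp_all
  have 1: "F (sum h S) = (\<Sum>i\<in>S. F (h i))" "G (sum h S) = (\<Sum>i\<in>S. G (h i))" for h and S :: "'w set"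
    by (induction S rule: infinite_finite_induct) (simp_all add: assms(1,2))
  have "F (lin_ext pm_scale (\<lambda>w. Poly_Mapping.single w 1) f) = G (lin_ext pm_scale (\<lambda>w. Poly_Mapping.single w 1) f)"
    by (simp add: lin_ext_def 1 assms(3))
  then show ?thesis by (simp flip: pm_eq_lin_ext)
qed

text \<open>Functoriality of monoid algebras; it makes \<open>in_left\<close>,
  \<open>in_right\<close> and \<open>coproduct\<close> multiplicative.\<close>

lemma pm_lin_ext_hom:
  fixes f g :: "'w::monoid_add \<Rightarrow>\<^sub>0 'k::comm_ring_1"
    and \<phi> :: "'w \<Rightarrow> ('v::monoid_add \<Rightarrow>\<^sub>0 'k)"
  assumes "\<And>u v. \<phi> (u + v) = \<phi> u * \<phi> v"
  shows "lin_ext pm_scale \<phi> (f * g) = lin_ext pm_scale \<phi> f * lin_ext pm_scale \<phi> g"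
  unfolding pm.lin_ext_mult assms
  by (simp add: lin_ext_def sum_product pm_scale_mult_left pm_scale_mult_right pm.scale_sum_right mult.commute)

lemma letters_simps [simp]: "letters 0 = []" "letters (u + v) = letters u @ letters v"
  by (simp_all add: zero_free_monoid_def plus_free_monoid_def)

lemma word_Nil: "word [] = 1"
  by (simp add: word_def zero_free_monoid_def[symmetric])

lemma word_Cons: "word (x # xs) = word [x] * word xs"
  using word_append[of "[x]" xs] by simp

lemma word_eq_prod_list: "word xs = prod_list (map (\<lambda>x. word [x]) xs)"
proof (induction xs)
  case (Cons x xs)
  then show ?case by (subst word_Cons) simp
qed (simp add: word_Nil)

lemma fa_eq_lin_ext: "f = lin_ext pm_scale (\<lambda>w. word (letters w)) f"
  by (subst pm_eq_lin_ext) (simp add: word_def)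


section \<open>The unshuffle coproduct and the Adams operation\<close>

text \<open>The tensor square of the free algebra is encoded as the monoid algebra of pairs of words
  with componentwise concatenation. \<open>in_left\<close> and \<open>in_right\<close> are the
  embeddings as first and second tensor factor.\<close>

definition in_left :: "('g free_monoid \<Rightarrow>\<^sub>0 'k::comm_ring_1) \<Rightarrow> ('g free_monoid \<times> 'g free_monoid \<Rightarrow>\<^sub>0 'k)" where
  "in_left = lin_ext pm_scale (\<lambda>w. Poly_Mapping.single (w, 0) 1)"

definition in_right :: "('g free_monoid \<Rightarrow>\<^sub>0 'k::comm_ring_1) \<Rightarrow> ('g free_monoid \<times> 'g free_monoid \<Rightarrow>\<^sub>0 'k)" where
  "in_right = lin_ext pm_scale (\<lambda>w. Poly_Mapping.single (0, w) 1)"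

definition mult_out :: "('g free_monoid \<times> 'g free_monoid \<Rightarrow>\<^sub>0 'k::comm_ring_1) \<Rightarrow> ('g free_monoid \<Rightarrow>\<^sub>0 'k)" where
  "mult_out = lin_ext pm_scale (\<lambda>(u, v). Poly_Mapping.single (u + v) 1)"

definition coproduct :: "('g free_monoid \<Rightarrow>\<^sub>0 'k::comm_ring_1) \<Rightarrow> ('g free_monoid \<times> 'g free_monoid \<Rightarrow>\<^sub>0 'k)" where
  "coproduct = lin_ext pm_scale (\<lambda>w. prod_list (map (\<lambda>x. in_left (word [x]) + in_right (word [x])) (letters w)))"

definition adams :: "('g free_monoid \<Rightarrow>\<^sub>0 'k::comm_ring_1) \<Rightarrow> ('g free_monoid \<Rightarrow>\<^sub>0 'k)" where
  "adams f = mult_out (coproduct f)"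

lemmas linear_maps_def = in_left_def in_right_def mult_out_def coproduct_def

lemma linear_maps_add:
  "in_left (f + g) = in_left f + in_left g" "in_right (f + g) = in_right f + in_right g"
  "mult_out (p + q) = mult_out p + mult_out q" "coproduct (f + g) = coproduct f + coproduct g"
  "adams (f + g) = adams f + adams g"
  by (simp_all add: linear_maps_def adams_def pm.lin_ext_add)

lemma linear_maps_diff:
  "in_left (f - g) = in_left f - in_left g" "in_right (f - g) = in_right f - in_right g"
  "mult_out (p - q) = mult_out p - mult_out q" "coproduct (f - g) = coproduct f - coproduct g"
  "adams (f - g) = adams f - adams g"
  by (simp_all add: linear_maps_def adams_def pm.lin_ext_diff)

lemma linear_maps_zero [simp]:
  "in_left 0 = 0" "in_right 0 = 0" "mult_out 0 = 0" "coproduct 0 = 0" "adams 0 = 0"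
  by (simp_all add: linear_maps_def adams_def)

lemma linear_maps_scale:
  "in_left (pm_scale c f) = pm_scale c (in_left f)" "in_right (pm_scale c f) = pm_scale c (in_right f)"
  "mult_out (pm_scale c p) = pm_scale c (mult_out p)"
  "coproduct (pm_scale c f) = pm_scale c (coproduct f)"
  "adams (pm_scale c f) = pm_scale c (adams f)"
  by (simp_all add: linear_maps_def adams_def pm_lin_ext_scale)

lemma in_left_mult: "in_left (f * g) = in_left f * in_left g"
  and in_right_mult: "in_right (f * g) = in_right f * in_right g"
  and coproduct_mult: "coproduct (f * g) = coproduct f * coproduct g"
  unfolding linear_maps_def by (simp_all add: pm_lin_ext_hom mult_single)

lemma linear_maps_one [simp]: "in_left 1 = 1" "in_right 1 = 1" "coproduct 1 = 1"
  by (simp_all add: linear_maps_def single_one[symmetric] del: single_one)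
    (simp_all add: zero_prod_def)

lemma in_left_in_right_single:
  "in_left (Poly_Mapping.single u c) * in_right (Poly_Mapping.single v d) = Poly_Mapping.single (u, v) (c * d)"
  "in_right (Poly_Mapping.single v d) * in_left (Poly_Mapping.single u c) = Poly_Mapping.single (u, v) (c * d)"
  by (simp_all add: in_left_def in_right_def mult_single mult.commute)

lemma in_right_in_left: "in_right g * in_left f = in_left f * in_right g"
proof (rule pm_linear_eqI[where f = f])
  fix w c
  show "in_right g * in_left (Poly_Mapping.single w c) = in_left (Poly_Mapping.single w c) * in_right g"
    by (rule pm_linear_eqI[where f = g]) (simp_all add: linear_maps_add algebra_simps in_left_in_right_single)
qed (simp_all add: linear_maps_add algebra_simps)

lemma in_right_in_left_assoc: "in_right g * (in_left f * r) = in_left f * (in_right g * r)"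
  by (simp add: in_right_in_left flip: mult.assoc)

lemma mult_out_in_left_in_right: "mult_out (in_left f * in_right g) = f * g"
proof (rule pm_linear_eqI[where f = f])
  fix w c
  show "mult_out (in_left (Poly_Mapping.single w c) * in_right g) = Poly_Mapping.single w c * g"
    by (rule pm_linear_eqI[where f = g])
      (simp_all add: linear_maps_add algebra_simps in_left_in_right_single, simp add: mult_out_def mult_single mult.commute)
qed (simp_all add: linear_maps_add algebra_simps)

definition primitive :: "('g free_monoid \<Rightarrow>\<^sub>0 'k::comm_ring_1) \<Rightarrow> bool" where
  "primitive f \<longleftrightarrow> coproduct f = in_left f + in_right f"

lemma primitive_letter: "primitive (word [x])"
  by (simp add: primitive_def coproduct_def word_def)

lemma primitive_diff: "primitive f \<Longrightarrow> primitive g \<Longrightarrow> primitive (f - g)"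
  by (simp add: primitive_def linear_maps_diff)

lemma primitive_scale: "primitive f \<Longrightarrow> primitive (pm_scale c f)"
  by (simp add: primitive_def linear_maps_scale pm.scale_right_distrib)

text \<open>The mixed terms of the two products cancel because the two tensor factors commute with
  each other.\<close>

lemma primitive_commutator: "primitive f \<Longrightarrow> primitive g \<Longrightarrow> primitive (f * g - g * f)"
  by (simp add: primitive_def linear_maps_diff coproduct_mult in_left_mult in_right_mult
      in_right_in_left algebra_simps)

text \<open>Multiplying out either summand of the coproduct gives back \<open>f\<close>, so
  primitive elements are eigenvectors with eigenvalue 2.\<close>

lemma adams_primitive: "primitive f \<Longrightarrow> adams f = f + f"
  using mult_out_in_left_in_right[of f 1] mult_out_in_left_in_right[of 1 f]
  by (simp add: adams_def primitive_def linear_maps_add)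


text \<open>All splittings into two complementary subsequences. A list is used instead of a set so
  that coinciding splittings keep their multiplicity.\<close>

fun unshuffles :: "'a list \<Rightarrow> ('a list \<times> 'a list) list" where
  "unshuffles [] = [([], [])]"
| "unshuffles (x # xs) = map (apfst ((#) x)) (unshuffles xs) @ map (apsnd ((#) x)) (unshuffles xs)"

lemma length_unshuffles: "length (unshuffles xs) = 2 ^ length xs"
  by (induction xs) simp_all

lemma mset_unshuffles: "ys \<in> set (unshuffles xs) \<Longrightarrow> mset (fst ys @ snd ys) = mset xs"
  by (induction xs arbitrary: ys) (auto simp: image_iff)

lemma unshuffles_map: "unshuffles (map f xs) = map (map_prod (map f) (map f)) (unshuffles xs)"
  by (induction xs) (simp_all add: o_def apfst_def apsnd_def prod.map_comp)

text \<open>Expanding the product of the sums \<open>in_left l + in_right l\<close> means choosing a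
  side for every factor, which is an unshuffle.\<close>

lemma coproduct_prod_list:
  assumes "\<And>l. l \<in> set ls \<Longrightarrow> primitive l"
  shows "coproduct (prod_list ls) =
    (\<Sum>(as, bs)\<leftarrow>unshuffles ls. in_left (prod_list as) * in_right (prod_list bs))"
  using assms
proof (induction ls)
  case (Cons l ls)
  have *: "in_right l * (in_left a * in_right b) = in_left a * in_right (l * b)" for a b
    by (simp add: in_right_in_left in_right_mult mult.assoc flip: mult.assoc[of "in_right l" "in_left a"])
  have "coproduct (prod_list (l # ls)) = (in_left l + in_right l) * coproduct (prod_list ls)"
    using Cons.prems by (simp add: coproduct_mult primitive_def)
  also have "coproduct (prod_list ls) =
      (\<Sum>(as, bs)\<leftarrow>unshuffles ls. in_left (prod_list as) * in_right (prod_list bs))"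
    using Cons by simp
  also have "(in_left l + in_right l) * \<dots> =
      (\<Sum>(as, bs)\<leftarrow>unshuffles (l # ls). in_left (prod_list as) * in_right (prod_list bs))"
    by (simp add: distrib_right case_prod_unfold o_def flip: sum_list_const_mult)
      (simp add: * in_left_mult mult.assoc sum_list_addf)
  finally show ?case .
qed simp

lemma mult_out_sum_list: "mult_out (sum_list ps) = sum_list (map mult_out ps)"
  by (induction ps) (simp_all add: linear_maps_add)

lemma adams_prod_list:
  assumes "\<And>l. l \<in> set ls \<Longrightarrow> primitive l"
  shows "adams (prod_list ls) = (\<Sum>(as, bs)\<leftarrow>unshuffles ls. prod_list (as @ bs))"
proof -
  have "coproduct (prod_list ls) =
      (\<Sum>(as, bs)\<leftarrow>unshuffles ls. in_left (prod_list as) * in_right (prod_list bs))"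
    by (rule coproduct_prod_list) (rule assms)
  then show ?thesis
    by (simp add: adams_def mult_out_sum_list o_def case_prod_unfold mult_out_in_left_in_right)
qed

lemma adams_word:
  "adams (word xs :: 'g free_monoid \<Rightarrow>\<^sub>0 'k::comm_ring_1) = (\<Sum>(as, bs)\<leftarrow>unshuffles xs. word (as @ bs))"
proof -
  let ?ls = "map (\<lambda>x. word [x] :: 'g free_monoid \<Rightarrow>\<^sub>0 'k) xs"
  have "adams (prod_list ?ls) = (\<Sum>(as, bs)\<leftarrow>unshuffles ?ls. prod_list (as @ bs))"
    by (rule adams_prod_list) (auto simp: primitive_letter)
  then show ?thesis
    by (simp add: unshuffles_map o_def case_prod_unfold word_append flip: word_eq_prod_list)
qed


section \<open>Ideals generated by primitive elements\<close>

text \<open>The two-sided ideal generated by \<open>G\<close>. Words suffice as cofactors since they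
  span the free algebra.\<close>

definition two_sided :: "('g free_monoid \<Rightarrow>\<^sub>0 'k::comm_ring_1) set \<Rightarrow> ('g free_monoid \<Rightarrow>\<^sub>0 'k) set" where
  "two_sided G = pm.span {word u * g * word v | u g v. g \<in> G}"

lemma two_sided_closed:
  shows "0 \<in> two_sided G"
    and "f \<in> two_sided G \<Longrightarrow> g \<in> two_sided G \<Longrightarrow> f + g \<in> two_sided G"
    and "f \<in> two_sided G \<Longrightarrow> g \<in> two_sided G \<Longrightarrow> f - g \<in> two_sided G"
    and "f \<in> two_sided G \<Longrightarrow> pm_scale c f \<in> two_sided G"
    and "f \<in> two_sided G \<Longrightarrow> - f \<in> two_sided G"
  by (simp_all add: two_sided_def pm.span_zero pm.span_add pm.span_diff pm.span_scale pm.span_neg)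

lemma two_sided_base: "g \<in> G \<Longrightarrow> g \<in> two_sided G"
  unfolding two_sided_def by (rule pm.span_base) (force simp: word_Nil intro: exI[of _ "[]"])

lemma two_sided_mono: "G \<subseteq> H \<Longrightarrow> two_sided G \<subseteq> two_sided H"
  unfolding two_sided_def by (rule pm.span_mono) blast

lemma two_sided_induct [consumes 1, case_names gen zero add scale]:
  assumes "f \<in> two_sided G"
    and "\<And>u g v. g \<in> G \<Longrightarrow> Q (word u * g * word v)" "Q 0"
    and "\<And>f g. Q f \<Longrightarrow> Q g \<Longrightarrow> Q (f + g)" "\<And>c f. Q f \<Longrightarrow> Q (pm_scale c f)"
  shows "Q f"
  using assms(1) unfolding two_sided_def
  by (induction rule: pm.span_induct) (auto simp: pm.subspace_def assms(2-5))

lemma two_sided_mult: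
  assumes f: "f \<in> two_sided G"
  shows "h * f \<in> two_sided G" "f * h \<in> two_sided G"
proof -
  have base: "word u * g * word v \<in> two_sided G" if "g \<in> G" for u g v
    unfolding two_sided_def using that by (intro pm.span_base) blast
  have words: "word u * f \<in> two_sided G" "f * word u \<in> two_sided G" for u
    using f
  proof (induction rule: two_sided_induct)
    case (gen u' g v)
    {
      case 1
      show ?case using base[OF gen, of "u @ u'" v]
        by (simp add: word_append mult.assoc)
    next
      case 2
      show ?case using base[OF gen, of u' "v @ u"]
        by (simp add: word_append mult.assoc)
    }
  qed (simp_all add: two_sided_closed distrib_left distrib_right pm_scale_mult_left pm_scale_mult_right)
  have sum: "lin_ext pm_scale \<phi> h \<in> two_sided G" if "\<And>w. \<phi> w \<in> two_sided G" for \<phi>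
    unfolding lin_ext_def two_sided_def
    by (intro pm.span_sum pm.span_scale) (use that in \<open>simp add: two_sided_def\<close>)
  have "h * f = lin_ext pm_scale (\<lambda>w. word (letters w) * f) h"
    by (subst fa_eq_lin_ext[of h]) (simp add: lin_ext_def sum_distrib_right pm_scale_mult_left)
  then show "h * f \<in> two_sided G" by (simp add: sum words)
  have "f * h = lin_ext pm_scale (\<lambda>w. f * word (letters w)) h"
    by (subst fa_eq_lin_ext[of h]) (simp add: lin_ext_def sum_distrib_left pm_scale_mult_right)
  then show "f * h \<in> two_sided G" by (simp add: sum words)
qed

text \<open>The tensor square is spanned by pure tensors: a basis pair with a coefficient is one,
  the coefficient being put on the left factor.\<close>

lemma tensor_square_induct [case_names pure zero add scale]:
  assumes "\<And>f g. Q (in_left f * in_right g)" "Q 0"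
    and "\<And>p q. Q p \<Longrightarrow> Q q \<Longrightarrow> Q (p + q)" "\<And>c p. Q p \<Longrightarrow> Q (pm_scale c p)"
  shows "Q p"
proof -
  have "Q (\<Sum>w\<in>A. Poly_Mapping.single w (c w))" if "finite A" for A c
    using that
  proof induction
    case (insert w A)
    have "Q (Poly_Mapping.single w (c w))"
      using assms(1)[of "Poly_Mapping.single (fst w) (c w)" "Poly_Mapping.single (snd w) 1"]
      by (simp add: in_left_in_right_single)
    then show ?case using insert by (simp add: assms(3))
  qed (simp add: assms(2))
  from this[of "Poly_Mapping.keys p" "Poly_Mapping.lookup p"] show ?thesis
    using pm_eq_lin_ext[of p] by (simp add: lin_ext_def)
qed

text \<open>For a generator \<open>g\<close>, the coproduct of \<open>word u * g * word v\<close> is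
  a sum of two terms in which \<open>g\<close> occurs in one tensor factor only. Multiplying out
  leaves \<open>g\<close> as a factor, whatever surrounds it.\<close>

lemma adams_two_sided:
  assumes prim: "\<And>g. g \<in> G \<Longrightarrow> primitive g" and "f \<in> two_sided G"
  shows "adams f \<in> two_sided G"
  using assms(2)
proof (induction rule: two_sided_induct)
  case (gen u g v)
  have "mult_out (p * in_left g * q) \<in> two_sided G" for p q
  proof (induction p rule: tensor_square_induct)
    case (pure a b)
    show ?case
    proof (induction q rule: tensor_square_induct)
      case (pure c d)
      have "in_left a * in_right b * in_left g * (in_left c * in_right d) =
          in_left (a * g * c) * in_right (b * d)"
        by (simp add: in_left_mult in_right_mult mult.assoc in_right_in_left in_right_in_left_assoc)
      then show ?case
        using gen by (simp add: mult_out_in_left_in_right two_sided_mult two_sided_base)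
    qed (simp_all add: distrib_left linear_maps_add linear_maps_scale two_sided_closed pm_scale_mult_right)
  qed (simp_all add: distrib_right linear_maps_add linear_maps_scale two_sided_closed pm_scale_mult_left)
  moreover have "mult_out (p * in_right g * q) \<in> two_sided G" for p q
  proof (induction p rule: tensor_square_induct)
    case (pure a b)
    show ?case
    proof (induction q rule: tensor_square_induct)
      case (pure c d)
      have "in_left a * in_right b * in_right g * (in_left c * in_right d) =
          in_left (a * c) * in_right (b * g * d)"
        by (simp add: in_left_mult in_right_mult mult.assoc in_right_in_left in_right_in_left_assoc)
      then show ?case
        using gen by (simp add: mult_out_in_left_in_right two_sided_mult two_sided_base)
    qed (simp_all add: distrib_left linear_maps_add linear_maps_scale two_sided_closed pm_scale_mult_right)
  qed (simp_all add: distrib_right linear_maps_add linear_maps_scale two_sided_closed pm_scale_mult_left)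
  ultimately show ?case
    using prim[OF gen] by (simp add: adams_def coproduct_mult primitive_def distrib_left distrib_right
        linear_maps_add two_sided_closed)
qed (simp_all add: linear_maps_add linear_maps_scale two_sided_closed)


section \<open>Triangularity of the Adams operation\<close>

locale lie_closed_primitives =
  fixes M :: "('g free_monoid \<Rightarrow>\<^sub>0 'k::comm_ring_1) set"
  assumes primitive_M: "l \<in> M \<Longrightarrow> primitive l"
    and commutator_M: "l \<in> M \<Longrightarrow> m \<in> M \<Longrightarrow> l * m - m * l \<in> M"
begin

text \<open>Excluding the empty product makes \<open>filt 0\<close> zero and \<open>filt 1\<close>
  the span of \<open>M\<close>, where the descent is to end.\<close>

definition filt :: "nat \<Rightarrow> ('g free_monoid \<Rightarrow>\<^sub>0 'k) set" where
  "filt j = pm.span {prod_list ls | ls. set ls \<subseteq> M \<and> ls \<noteq> [] \<and> length ls \<le> j}"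

lemma filt_closed:
  shows "0 \<in> filt j"
    and "f \<in> filt j \<Longrightarrow> g \<in> filt j \<Longrightarrow> f + g \<in> filt j"
    and "f \<in> filt j \<Longrightarrow> g \<in> filt j \<Longrightarrow> f - g \<in> filt j"
    and "f \<in> filt j \<Longrightarrow> pm_scale c f \<in> filt j"
    and "set ls \<subseteq> M \<Longrightarrow> ls \<noteq> [] \<Longrightarrow> length ls \<le> j \<Longrightarrow> prod_list ls \<in> filt j"
  by (auto simp: filt_def pm.span_zero pm.span_add pm.span_diff pm.span_scale intro!: pm.span_base)

lemma filt_mono: "i \<le> j \<Longrightarrow> filt i \<subseteq> filt j"
  unfolding filt_def by (rule pm.span_mono) force

lemma filt_induct [consumes 1, case_names prod zero add scale]:
  assumes "f \<in> filt j"
    and "\<And>ls. set ls \<subseteq> M \<Longrightarrow> ls \<noteq> [] \<Longrightarrow> length ls \<le> j \<Longrightarrow> Q (prod_list ls)" "Q 0"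
    and "\<And>f g. Q f \<Longrightarrow> Q g \<Longrightarrow> Q (f + g)" "\<And>c f. Q f \<Longrightarrow> Q (pm_scale c f)"
  shows "Q f"
  using assms(1) unfolding filt_def
  by (induction rule: pm.span_induct) (auto simp: pm.subspace_def assms(2-5))

lemma filt_mult_left:
  assumes "l \<in> M" "f \<in> filt j"
  shows "l * f \<in> filt (Suc j)"
  using assms(2)
proof (induction rule: filt_induct)
  case (prod ls)
  then show ?case using filt_closed(5)[of "l # ls" "Suc j"] assms(1) by simp
qed (simp_all add: filt_closed distrib_left pm_scale_mult_right)

text \<open>Moving \<open>x\<close> to the left past \<open>u\<close> costs the commutator of
  \<open>u\<close> and \<open>x\<close>. It lies in \<open>M\<close> and replaces two factors by
  one, so the error has one factor less.\<close>

lemma prod_list_move: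
  assumes "set (us @ x # vs) \<subseteq> M"
  shows "prod_list (us @ x # vs) - prod_list (x # us @ vs) \<in> filt (length us + length vs)"
  using assms
proof (induction us)
  case (Cons u us)
  have "prod_list ((u # us) @ x # vs) - prod_list (x # (u # us) @ vs) =
      u * (prod_list (us @ x # vs) - prod_list (x # us @ vs)) + prod_list ((u * x - x * u) # us @ vs)"
    by (simp add: algebra_simps)
  moreover have "u * (prod_list (us @ x # vs) - prod_list (x # us @ vs)) \<in> filt (length (u # us) + length vs)"
    using filt_mult_left[OF _ Cons.IH, of u] Cons.prems by simp
  moreover have "prod_list ((u * x - x * u) # us @ vs) \<in> filt (length (u # us) + length vs)"
    using Cons.prems by (intro filt_closed(5)) (auto simp: commutator_M)
  ultimately show ?case by (simp only: filt_closed(2))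
qed (simp add: filt_closed)

text \<open>Exchanging two adjacent factors changes a product by one with the commutator as a single factor.\<close>

lemma prod_list_mset_cong:
  assumes "set ls \<subseteq> M" "mset ms = mset ls"
  shows "prod_list ms - prod_list ls \<in> filt (length ls - 1)"
  using assms
proof (induction ls arbitrary: ms)
  case (Cons x ls)
  then have "x \<in> set ms" by (metis list.set_intros(1) mset_eq_setD)
  \<comment> \<open>The head \<open>x\<close> of the second list is located in \<open>ms\<close> and
    moved to the front; the remaining lists are compared by induction.\<close>
  then obtain us vs where ms: "ms = us @ x # vs" by (meson split_list)
  with Cons.prems have mset: "mset (us @ vs) = mset ls" by simp
  then have len: "length us + length vs = length ls" by (metis length_append mset_eq_length)
  have "set (us @ vs) = set ls" using mset by (rule mset_eq_setD)
  with Cons.prems have "prod_list ms - prod_list (x # us @ vs) \<in> filt (length ls)"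
    using prod_list_move[of us x vs] by (auto simp: ms len)
  moreover have "x * (prod_list (us @ vs) - prod_list ls) \<in> filt (length ls)"
  \<comment> \<open>For empty \<open>ls\<close> the bound \<open>length ls - 1\<close> truncates to
    0 and \<open>filt_mult_left\<close> would reach only \<open>filt 1\<close>; here the difference
    vanishes.\<close>
  proof (cases "ls = []")
    case True
    then show ?thesis using len by (simp add: filt_closed)
  next
    case False
    with filt_mult_left[OF _ Cons.IH[OF _ mset], of x] Cons.prems show ?thesis by simp
  qed
  ultimately have "(prod_list ms - prod_list (x # us @ vs)) + x * (prod_list (us @ vs) - prod_list ls) \<in> filt (length ls)"
    by (rule filt_closed(2))
  then show ?case by (simp add: right_diff_distrib)
qed (simp add: filt_closed)

text \<open>Each of the \<open>2 ^ length ls\<close> unshuffles, read as one list, rearranges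
  \<open>ls\<close>, so its product agrees with \<open>prod_list ls\<close> up to products with
  fewer factors.\<close>

lemma adams_prod_list_filt:
  assumes "set ls \<subseteq> M"
  shows "adams (prod_list ls) - pm_scale (2 ^ length ls) (prod_list ls) \<in> filt (length ls - 1)"
proof -
  have "(\<Sum>(as, bs)\<leftarrow>us. prod_list (as @ bs)) - pm_scale (of_nat (length us)) (prod_list ls) \<in> filt (length ls - 1)"
    if "\<And>u. u \<in> set us \<Longrightarrow> mset (fst u @ snd u) = mset ls" for us
    using that
  proof (induction us)
    case (Cons u us)
    have "(prod_list (fst u @ snd u) - prod_list ls)
        + ((\<Sum>(as, bs)\<leftarrow>us. prod_list (as @ bs)) - pm_scale (of_nat (length us)) (prod_list ls)) \<in> filt (length ls - 1)"
      using Cons by (intro filt_closed(2) prod_list_mset_cong assms) auto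
    then show ?case by (simp add: case_prod_unfold pm.scale_left_distrib algebra_simps)
  qed (simp add: filt_closed)
  from this[of "unshuffles ls"] have "(\<Sum>(as, bs)\<leftarrow>unshuffles ls. prod_list (as @ bs))
      - pm_scale (2 ^ length ls) (prod_list ls) \<in> filt (length ls - 1)"
    using mset_unshuffles[of _ ls] by (simp add: length_unshuffles)
  moreover have "adams (prod_list ls) = (\<Sum>(as, bs)\<leftarrow>unshuffles ls. prod_list (as @ bs))"
    by (rule adams_prod_list) (use assms primitive_M in blast)
  ultimately show ?thesis by simp
qed

lemma adams_filt:
  assumes "f \<in> filt (Suc j)"
  shows "pm_scale (2 ^ Suc j) f - adams f \<in> filt j"
  using assms
proof (induction rule: filt_induct)
  case (prod ls)
  have "length ls - 1 \<le> j" using prod(3) by simp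
  then have *: "adams (prod_list ls) - pm_scale (2 ^ length ls) (prod_list ls) \<in> filt j"
    using adams_prod_list_filt[OF prod(1)] filt_mono by blast
  \<comment> \<open>A product with fewer than \<open>Suc j\<close> factors lies in
    \<open>filt j\<close> itself, so the mismatch of eigenvalues does no harm.\<close>
  have "pm_scale (2 ^ Suc j) (prod_list ls) - pm_scale (2 ^ length ls) (prod_list ls) \<in> filt j"
  proof (cases "length ls = Suc j")
    case False
    then show ?thesis using prod by (intro filt_closed(3,4,5)) auto
  qed (simp add: filt_closed)
  from filt_closed(3)[OF this *] show ?case by (simp add: algebra_simps)
next
  case (add f g)
  from filt_closed(2)[OF this] show ?case by (simp add: pm.scale_right_distrib linear_maps_add algebra_simps)
next
  case (scale c f)
  from filt_closed(4)[OF this, of c] show ?case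
    by (simp add: pm.scale_right_diff_distrib linear_maps_scale mult.commute)
qed (simp add: filt_closed)

text \<open>Applying \<open>2 ^ (m + 2) - adams\<close> lowers the filtration by one step. Modulo
  the ideal it multiplies \<open>f\<close> by \<open>2 ^ (m + 2) - 2\<close>, which is a unit, so a
  solution for the image gives one for \<open>f\<close>.\<close>

lemma adams_eigenvector:
  assumes G: "\<And>g. g \<in> G \<Longrightarrow> primitive g" and unit: "\<And>m. (2 ^ (m + 2) - 2 :: 'k) dvd 1"
    and "f \<in> filt (Suc m)" "adams f - pm_scale 2 f \<in> two_sided G"
  shows "\<exists>l\<in>filt 1. f - l \<in> two_sided G"
  using assms(3,4)
proof (induction m arbitrary: f)
  case 0
  then show ?case using two_sided_closed(1)[of G] by (intro bexI[of _ f]) auto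
next
  case (Suc m)
  define g where "g = pm_scale (2 ^ (m + 2)) f - adams f"
  let ?e = "adams f - pm_scale 2 f"
  have "g \<in> filt (Suc m)" using adams_filt[OF Suc.prems(1)] by (simp add: g_def)
  \<comment> \<open>The image \<open>g\<close> is again an eigenvector modulo the ideal, since
    \<open>adams\<close> preserves the ideal.\<close>
  moreover have "adams g - pm_scale 2 g = pm_scale (2 ^ (m + 2)) ?e - adams ?e"
    by (simp add: g_def linear_maps_diff linear_maps_scale pm.scale_right_diff_distrib algebra_simps)
  then have "adams g - pm_scale 2 g \<in> two_sided G"
    using adams_two_sided[OF G Suc.prems(2)] Suc.prems(2) by (simp add: two_sided_closed)
  ultimately obtain l where l: "l \<in> filt 1" "g - l \<in> two_sided G" using Suc.IH by blast
  obtain e where e: "1 = (2 ^ (m + 2) - 2) * (e :: 'k)" using unit[of m] by (rule dvdE)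
  have "pm_scale (2 ^ (m + 2) - 2) f - l = (g - l) + ?e"
    by (simp add: g_def pm.scale_left_diff_distrib)
  also have "\<dots> \<in> two_sided G" using l(2) Suc.prems(2) by (rule two_sided_closed(2))
  finally have "pm_scale e (pm_scale (2 ^ (m + 2) - 2) f - l) \<in> two_sided G" by (rule two_sided_closed)
  moreover have "pm_scale e (pm_scale (2 ^ (m + 2) - 2) f) = f"
    using e by (metis mult.commute pm.scale_one pm.scale_scale)
  ultimately have "f - pm_scale e l \<in> two_sided G" by (simp add: pm.scale_right_diff_distrib)
  then show ?case using l(1) filt_closed(4) by blast
qed

end


section \<open>Relators of the tensor and enveloping algebras\<close>

definition linear_relators :: "('k::comm_ring_1 \<Rightarrow> 'g::ab_group_add \<Rightarrow> 'g) \<Rightarrow> ('g free_monoid \<Rightarrow>\<^sub>0 'k) set" where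
  "linear_relators scale = {word [x + y] - word [x] - word [y] | x y. True} \<union>
     {word [scale c x] - pm_scale c (word [x]) | c x. True}"

definition bracket_relators :: "('g \<Rightarrow> 'g \<Rightarrow> 'g) \<Rightarrow> ('g free_monoid \<Rightarrow>\<^sub>0 'k::comm_ring_1) set" where
  "bracket_relators br = {word [x] * word [y] - word [y] * word [x] - word [br x y] | x y. True}"

text \<open>The kernel of the map from the free algebra onto the enveloping algebra, described
  without passing through two successive quotients; \<open>env_proj_tensor_coset_eq_iff\<close>
  justifies it.\<close>

definition env_null ::
    "('k::comm_ring_1 \<Rightarrow> 'g::ab_group_add \<Rightarrow> 'g) \<Rightarrow> ('g \<Rightarrow> 'g \<Rightarrow> 'g) \<Rightarrow> ('g free_monoid \<Rightarrow>\<^sub>0 'k) set" where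
  "env_null scale br = two_sided (linear_relators scale \<union> bracket_relators br)"

section \<open>Homogeneous elements and the weight operator\<close>

definition homogeneous :: "nat \<Rightarrow> ('g free_monoid \<Rightarrow>\<^sub>0 'k::comm_ring_1) \<Rightarrow> bool" where
  "homogeneous n f \<longleftrightarrow> (\<forall>w\<in>Poly_Mapping.keys f. length (letters w) = n)"

lemma homogeneous_word: "homogeneous (length xs) (word xs)"
  by (simp add: homogeneous_def word_def)

lemma homogeneous_mult: "homogeneous m f \<Longrightarrow> homogeneous n g \<Longrightarrow> homogeneous (m + n) (f * g)"
  using keys_mult[of f g] by (fastforce simp: homogeneous_def)

lemma homogeneous_diff: "homogeneous n f \<Longrightarrow> homogeneous n g \<Longrightarrow> homogeneous n (f - g)"
  using keys_diff[of f g] by (auto simp: homogeneous_def)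

lemma homogeneous_scale: "homogeneous n f \<Longrightarrow> homogeneous n (pm_scale c f)"
  by (auto simp: homogeneous_def in_keys_iff)

lemma homogeneous_sum: "(\<And>i. i \<in> A \<Longrightarrow> homogeneous n (h i)) \<Longrightarrow> homogeneous n (sum h A)"
  using keys_sum[of h A] by (auto simp: homogeneous_def)

lemma homogeneous_linear_relators: "g \<in> linear_relators scale \<Longrightarrow> homogeneous 1 g"
  using homogeneous_word[of "[_]"]
  by (auto simp: linear_relators_def intro!: homogeneous_diff homogeneous_scale)

text \<open>Multiplication by \<open>n (n - 1)\<close> in degree \<open>n\<close>.  It has to be defined in all degrees, since the
  combination of Lie monomials obtained from \<open>P\<close> need not be homogeneous.\<close>

definition weight :: "('g free_monoid \<Rightarrow>\<^sub>0 'k::comm_ring_1) \<Rightarrow> ('g free_monoid \<Rightarrow>\<^sub>0 'k)" where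
  "weight = lin_ext pm_scale (\<lambda>w. Poly_Mapping.single w (of_nat (length (letters w) * (length (letters w) - 1))))"

lemma weight_homogeneous: "homogeneous n f \<Longrightarrow> weight f = pm_scale (of_nat (n * (n - 1))) f"
  by (subst (2) pm_eq_lin_ext)
    (simp add: weight_def lin_ext_def homogeneous_def pm.scale_sum_right mult.commute)

lemma weight_linear:
  "weight (f + g) = weight f + weight g" "weight (f - g) = weight f - weight g" "weight 0 = 0"
  "weight (pm_scale c f) = pm_scale c (weight f)"
  by (simp_all add: weight_def pm.lin_ext_add pm.lin_ext_diff pm_lin_ext_scale)

lemma primitive_linear_relators: "g \<in> linear_relators scale \<Longrightarrow> primitive g"
  by (auto simp: linear_relators_def intro!: primitive_diff primitive_scale primitive_letter)

lemma primitive_bracket_relators: "g \<in> bracket_relators br \<Longrightarrow> primitive g"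
  by (auto simp: bracket_relators_def intro!: primitive_diff primitive_commutator primitive_letter)

text \<open>A multilinear relation is a linear relator on one letter with words on both sides. This
  exhibits \<open>tensor_null\<close> as an ideal generated by primitive elements.\<close>

lemma tensor_null_eq_two_sided: "tensor_null scale = two_sided (linear_relators scale)"
proof -
  have "multilinear_relations scale = {word u * g * word v | u g v. g \<in> linear_relators scale}"
    (is "?A = ?B")
  proof (intro equalityI subsetI)
    fix r assume "r \<in> ?A"
    then consider
      (add) u x y v where "r = word (u @ [x + y] @ v) - word (u @ [x] @ v) - word (u @ [y] @ v)"
    | (scale) u c x v where "r = word (u @ [scale c x] @ v) - fa_scale c (word (u @ [x] @ v))"
      unfolding multilinear_relations_def by blast
    then show "r \<in> ?B"
    proof cases
      case add
      then have "r = word u * (word [x + y] - word [x] - word [y]) * word v"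
        by (simp only: word_append mult.assoc left_diff_distrib right_diff_distrib)
      then show ?thesis unfolding linear_relators_def by blast
    next
      case scale
      then have "r = word u * (word [scale c x] - pm_scale c (word [x])) * word v"
        by (simp only: word_append mult.assoc left_diff_distrib right_diff_distrib
            pm_scale_mult_left pm_scale_mult_right fa_scale_eq_pm_scale)
      then show ?thesis unfolding linear_relators_def by blast
    qed
  next
    fix r assume "r \<in> ?B"
    then consider
      (add) u x y v where "r = word u * (word [x + y] - word [x] - word [y]) * word v"
    | (scale) u c x v where "r = word u * (word [scale c x] - pm_scale c (word [x])) * word v"
      unfolding linear_relators_def by blast
    then show "r \<in> ?A"
    proof cases
      case add
      then have "r = word (u @ [x + y] @ v) - word (u @ [x] @ v) - word (u @ [y] @ v)"
        by (simp only: word_append mult.assoc left_diff_distrib right_diff_distrib)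
      then show ?thesis unfolding multilinear_relations_def by blast
    next
      case scale
      then have "r = word (u @ [scale c x] @ v) - fa_scale c (word (u @ [x] @ v))"
        by (simp only: word_append mult.assoc left_diff_distrib right_diff_distrib
            pm_scale_mult_left pm_scale_mult_right fa_scale_eq_pm_scale)
      then show ?thesis unfolding multilinear_relations_def by blast
    qed
  qed
  then show ?thesis by (simp add: tensor_null_def two_sided_def fa_scale_eq_pm_scale)
qed

lemma tensor_null_subset_env_null: "tensor_null scale \<subseteq> env_null scale br"
  unfolding tensor_null_eq_two_sided env_null_def by (rule two_sided_mono) blast

lemma env_null_letter:
  shows "word [x + y] - word [x] - word [y] \<in> env_null scale br"
    and "word [scale c x] - pm_scale c (word [x]) \<in> env_null scale br"
    and "word [x] * word [y] - word [y] * word [x] - word [br x y] \<in> env_null scale br"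
  unfolding env_null_def linear_relators_def bracket_relators_def
  by (rule two_sided_base, blast)+


section \<open>Iterated commutators of Lie monomials\<close>

lemma commutator_L_append: "v \<noteq> [] \<Longrightarrow> commutator_L br (u @ v) = foldr br u (commutator_L br v)"
proof (induction u)
  case (Cons x u)
  then show ?case by (cases "u @ v") auto
qed simp

lemma commutator_R_append: "u \<noteq> [] \<Longrightarrow> commutator_R br (u @ v) = foldl br (commutator_R br u) v"
  by (cases u) simp_all

definition split_commutators :: "('g::ab_group_add \<Rightarrow> 'g \<Rightarrow> 'g) \<Rightarrow> 'g list \<Rightarrow> 'g" where
  "split_commutators br w =
     (\<Sum>p = 1..length w - 1. br (commutator_L br (take p w)) (commutator_R br (drop p w)))"

context lie_algebra
begin

section \<open>Bracket identities and multilinearity of iterated commutators\<close>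

lemma bracket_zero [simp]: "bracket 0 y = 0" "bracket x 0 = 0"
  using bracket_add_left[of 0 0 y] bracket_add_right[of x 0 0] by simp_all

lemma bracket_minus_right: "bracket x (- y) = - bracket x y"
  using bracket_add_right[of x y "- y"] by (simp add: minus_unique)

lemma bracket_antisym: "bracket y x = - bracket x y"
proof -
  have "bracket x y + bracket y x = bracket (x + y) (x + y)"
    by (simp only: bracket_add_left bracket_add_right) (simp add: bracket_self)
  then have "bracket x y + bracket y x = 0" by (simp only: bracket_self)
  then show ?thesis by (simp add: minus_unique)
qed

lemma bracket_sum_left: "bracket (\<Sum>i\<in>A. f i) y = (\<Sum>i\<in>A. bracket (f i) y)"
  by (induction A rule: infinite_finite_induct) (simp_all add: bracket_add_left)

text \<open>The Jacobi identity in the form that the adjoint action of a bracket is the commutator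
  of the adjoint actions.\<close>

lemma bracket_bracket: "bracket (bracket x y) z = bracket x (bracket y z) - bracket y (bracket x z)"
proof -
  have "bracket x (bracket y z) + bracket y (- bracket x z) - bracket (bracket x y) z = 0"
    using jacobi[of x y z] by (metis bracket_antisym diff_conv_add_uminus)
  then show ?thesis by (simp add: bracket_minus_right algebra_simps)
qed

definition linear_map :: "('g \<Rightarrow> 'g) \<Rightarrow> bool" where
  "linear_map h \<longleftrightarrow> (\<forall>x y. h (x + y) = h x + h y) \<and> (\<forall>c x. h (scale c x) = scale c (h x))"

definition multilinear :: "('g list \<Rightarrow> 'g) \<Rightarrow> bool" where
  "multilinear \<phi> \<longleftrightarrow> (\<forall>u v. linear_map (\<lambda>x. \<phi> (u @ [x] @ v)))"

lemma linear_map_intros: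
  "linear_map (\<lambda>x. x)"
  "linear_map h \<Longrightarrow> linear_map (\<lambda>x. bracket (h x) a)"
  "linear_map h \<Longrightarrow> linear_map (\<lambda>x. bracket a (h x))"
  "(\<And>i. i \<in> A \<Longrightarrow> linear_map (h' i)) \<Longrightarrow> linear_map (\<lambda>x. \<Sum>i\<in>A. h' i x)"
  by (auto simp: linear_map_def bracket_add_left bracket_add_right bracket_scale_left
      bracket_scale_right sum.distrib scale_sum_right)

lemma linear_map_foldr: "linear_map h \<Longrightarrow> linear_map (\<lambda>x. foldr bracket u (h x))"
  by (induction u) (auto intro: linear_map_intros)

lemma linear_map_foldl: "linear_map h \<Longrightarrow> linear_map (\<lambda>x. foldl bracket (h x) v)"
  by (induction v arbitrary: h) (auto intro: linear_map_intros)

lemma multilinear_commutator_L: "multilinear (commutator_L bracket)"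
proof -
  have "linear_map (\<lambda>x. commutator_L bracket (u @ [x] @ v))" for u v
  proof (cases v)
    case Nil
    then show ?thesis by (simp add: commutator_L_append linear_map_foldr linear_map_intros)
  next
    case (Cons y ys)
    then show ?thesis by (simp add: commutator_L_append linear_map_foldr linear_map_intros)
  qed
  then show ?thesis by (simp add: multilinear_def)
qed

lemma multilinear_commutator_R: "multilinear (commutator_R bracket)"
proof -
  have "linear_map (\<lambda>x. commutator_R bracket (u @ [x] @ v))" for u v
    by (cases u) (simp_all add: linear_map_foldl linear_map_intros)
  then show ?thesis by (simp add: multilinear_def)
qed

lemma multilinear_split_commutators: "multilinear (split_commutators bracket)"
proof -
  note lin = multilinear_commutator_L[unfolded multilinear_def, rule_format]
    multilinear_commutator_R[unfolded multilinear_def, rule_format]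
  have "linear_map (\<lambda>x. bracket (commutator_L bracket (take p (u @ [x] @ v)))
      (commutator_R bracket (drop p (u @ [x] @ v))))" for p u v
  \<comment> \<open>The varying letter lies to the right of the cut in the first case and to the
    left of it in the second.\<close>
  proof (cases "p \<le> length u")
    case True
    then show ?thesis
      using linear_map_intros(3)[OF lin(2)[of "drop p u" v]] by simp
  next
    case False
    then obtain q where "p = length u + Suc q" by (metis add_Suc_right less_imp_Suc_add not_le)
    then show ?thesis
      using linear_map_intros(2)[OF lin(1)[of u "take q v"]] by simp
  qed
  then show ?thesis
    unfolding multilinear_def split_commutators_def
    by (auto intro!: linear_map_intros)
qed

section \<open>Linear extension of functions of words to the free algebra\<close>

definition evaluate :: "('g list \<Rightarrow> 'g) \<Rightarrow> ('g free_monoid \<Rightarrow>\<^sub>0 'k) \<Rightarrow> 'g" where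
  "evaluate \<phi> = lin_ext scale (\<lambda>w. \<phi> (letters w))"

lemma evaluate_word [simp]: "evaluate \<phi> (word w) = \<phi> w"
  by (simp add: evaluate_def word_def)

lemma evaluate_linear:
  "evaluate \<phi> (f + g) = evaluate \<phi> f + evaluate \<phi> g"
  "evaluate \<phi> (f - g) = evaluate \<phi> f - evaluate \<phi> g"
  "evaluate \<phi> 0 = 0"
  "evaluate \<phi> (pm_scale c f) = scale c (evaluate \<phi> f)"
  "evaluate \<phi> (sum h A) = (\<Sum>i\<in>A. evaluate \<phi> (h i))"
  by (simp_all add: evaluate_def lin_ext_add lin_ext_diff lin_ext_sum lin_ext_pm_scale[OF module_axioms])

lemma evaluate_mult: "evaluate \<phi> (f * g) = evaluate (\<lambda>u. evaluate (\<lambda>v. \<phi> (u @ v)) g) f"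
  by (simp add: evaluate_def lin_ext_mult)

lemma evaluate_swap:
  "evaluate (\<lambda>u. evaluate (\<lambda>v. \<phi> u v) g) f = evaluate (\<lambda>v. evaluate (\<lambda>u. \<phi> u v) f) g"
  unfolding evaluate_def by (rule lin_ext_swap)

lemma evaluate_linear_map: "linear_map h \<Longrightarrow> evaluate (\<lambda>w. h (\<phi> w)) f = h (evaluate \<phi> f)"
  unfolding evaluate_def by (rule lin_ext_linear) (auto simp: linear_map_def)

lemmas evaluate_bracket =
  evaluate_linear_map[OF linear_map_intros(2)[OF linear_map_intros(1)]]
  evaluate_linear_map[OF linear_map_intros(3)[OF linear_map_intros(1)]]

lemma evaluate_fun:
  "evaluate (\<lambda>w. \<phi> w + \<psi> w) f = evaluate \<phi> f + evaluate \<psi> f"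
  "evaluate (\<lambda>w. \<Sum>i\<in>A. \<theta> i w) f = (\<Sum>i\<in>A. evaluate (\<theta> i) f)"
  "evaluate (\<lambda>w. scale c (\<phi> w)) f = scale c (evaluate \<phi> f)"
  using evaluate_linear_map[of "scale c" \<phi>]
  by (simp_all add: evaluate_def lin_ext_add_fun lin_ext_sum_fun linear_map_def scale_right_distrib mult.commute)

lemma evaluate_cong:
  "(\<And>w. w \<in> Poly_Mapping.keys f \<Longrightarrow> \<phi> (letters w) = \<psi> (letters w)) \<Longrightarrow> evaluate \<phi> f = evaluate \<psi> f"
  unfolding evaluate_def by (rule lin_ext_cong) simp

text \<open>This is the universal property of the tensor powers: a multilinear \<open>\<phi>\<close>
  can be evaluated on tensors.\<close>

lemma evaluate_tensor_null:
  assumes "multilinear \<phi>" "f \<in> tensor_null scale"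
  shows "evaluate \<phi> f = 0"
  using assms(2) unfolding tensor_null_def fa_scale_eq_pm_scale
proof (induction rule: pm.span_induct)
  case base
  show ?case by (simp add: pm.subspace_def evaluate_linear)
next
  case (step f)
  note lin = assms(1)[unfolded multilinear_def linear_map_def]
  from step consider
    (add) u x y v where "f = word (u @ [x + y] @ v) - word (u @ [x] @ v) - word (u @ [y] @ v)"
  | (scale) u c x v where "f = word (u @ [scale c x] @ v) - fa_scale c (word (u @ [x] @ v))"
    unfolding multilinear_relations_def by blast
  then show ?case
  proof cases
    case add
    then show ?thesis using lin by (simp only: evaluate_linear evaluate_word) simp
  next
    case scale
    then show ?thesis using lin
      by (simp only: evaluate_linear evaluate_word fa_scale_eq_pm_scale) simp
  qed
qed

end

text \<open>An iterated commutator of \<open>k\<close> letters is recorded both as an element of the free algebra and by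
  its value in the Lie algebra.\<close>

inductive lie_monomial ::
    "('g \<Rightarrow> 'g \<Rightarrow> 'g) \<Rightarrow> nat \<Rightarrow> ('g free_monoid \<Rightarrow>\<^sub>0 'k::comm_ring_1) \<Rightarrow> 'g \<Rightarrow> bool" for br where
  letter: "lie_monomial br 1 (word [x]) x"
| commutator: "lie_monomial br k f x \<Longrightarrow> lie_monomial br l g y \<Longrightarrow>
    lie_monomial br (k + l) (f * g - g * f) (br x y)"

lemma homogeneous_lie_monomial: "lie_monomial br k f x \<Longrightarrow> homogeneous k f"
proof (induction rule: lie_monomial.induct)
  case (commutator k f x l g y)
  then show ?case
    using homogeneous_mult[of k f l g] homogeneous_mult[of l g k f] by (simp add: homogeneous_diff add.commute)
qed (use homogeneous_word[of "[_]"] in simp)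

lemma keys_lie_monomial:
  "lie_monomial br k f x \<Longrightarrow> w \<in> Poly_Mapping.keys f \<Longrightarrow> length (letters w) = k"
  using homogeneous_lie_monomial[of br k f x] by (simp add: homogeneous_def)

lemma lie_monomial_pos: "lie_monomial br k f x \<Longrightarrow> k > 0"
  by (induction rule: lie_monomial.induct) auto

lemma primitive_lie_monomial: "lie_monomial br k f x \<Longrightarrow> primitive f"
  by (induction rule: lie_monomial.induct) (auto intro: primitive_letter primitive_commutator)

lemma lie_monomial_env_null:
  assumes "lie_monomial br k f x"
  shows "f - word [x] \<in> env_null scale br"
  using assms
proof induction
  case (letter x)
  then show ?case by (simp add: env_null_def two_sided_closed)
next
  case (commutator k f x l g y)
  \<comment> \<open>The factors \<open>f\<close> and \<open>g\<close> are replaced by the letters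
    \<open>x\<close> and \<open>y\<close> one at a time; a bracket relator remains.\<close>
  have "f * g - g * f - word [br x y] =
      (f - word [x]) * g + word [x] * (g - word [y]) - (g - word [y]) * f - word [y] * (f - word [x])
      + (word [x] * word [y] - word [y] * word [x] - word [br x y])"
    by (simp add: algebra_simps)
  also have "\<dots> \<in> env_null scale br"
    using commutator.IH env_null_letter(3)[of x y br scale]
    by (simp add: env_null_def two_sided_closed two_sided_mult)
  finally show ?case .
qed

context lie_algebra
begin

text \<open>Prepending a word to a left-nested commutator composes adjoint actions of its letters,
  so by the Jacobi identity a Lie monomial acts as its value does. Appending to
  \<open>commutator_R\<close> is the mirror image. The nonempty \<open>w\<close> supplies the
  element acted on.\<close>

lemma lie_monomial_acts:
  assumes "lie_monomial bracket k f x" "w \<noteq> []"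
  shows "evaluate (\<lambda>v. commutator_L bracket (v @ w)) f = bracket x (commutator_L bracket w)"
    and "evaluate (\<lambda>v. commutator_R bracket (w @ v)) f = bracket (commutator_R bracket w) x"
  using assms
proof (induction arbitrary: w)
  case (letter x)
  { case 1 then show ?case by (simp add: commutator_L_append)
  next case 2 then show ?case by (simp add: commutator_R_append) }
next
  case (commutator k f x l g y)
  {
    case 1
    then show ?case
      by (simp add: evaluate_linear evaluate_mult evaluate_swap[of _ g f] evaluate_swap[of _ f g]
          commutator.IH evaluate_bracket bracket_bracket)
  next
    case 2
    have "evaluate (\<lambda>v. commutator_R bracket (w @ v)) (f * g - g * f) =
      bracket (bracket (commutator_R bracket w) x) y - bracket (bracket (commutator_R bracket w) y) x"
      using 2
      by (simp add: evaluate_linear evaluate_mult commutator.IH evaluate_bracket flip: append_assoc)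
    also have "\<dots> = bracket (commutator_R bracket w) (bracket x y)"
      using bracket_antisym[of x "bracket (commutator_R bracket w) y"]
      by (simp add: bracket_bracket[of _ x y])
    finally show ?case .
  }
qed

text \<open>\<open>0\<close> is the empty word; its absence from \<open>g\<close> provides the
  nonempty tail that \<open>lie_monomial_acts\<close> requires.\<close>

lemma evaluate_commutator_L_mult:
  assumes "lie_monomial bracket k f x" "0 \<notin> Poly_Mapping.keys g"
  shows "evaluate (commutator_L bracket) (f * g) = bracket x (evaluate (commutator_L bracket) g)"
proof -
  have "evaluate (commutator_L bracket) (f * g) =
      evaluate (\<lambda>v. evaluate (\<lambda>u. commutator_L bracket (u @ v)) f) g"
    by (simp add: evaluate_mult evaluate_swap[of _ g f])
  also have "\<dots> = evaluate (\<lambda>v. bracket x (commutator_L bracket v)) g"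
    using assms(2) by (intro evaluate_cong lie_monomial_acts(1)[OF assms(1)]) (metis free_monoid.collapse zero_free_monoid_def)
  finally show ?thesis by (simp add: evaluate_bracket)
qed

lemma evaluate_commutator_R_mult:
  assumes "lie_monomial bracket k f x" "0 \<notin> Poly_Mapping.keys g"
  shows "evaluate (commutator_R bracket) (g * f) = bracket (evaluate (commutator_R bracket) g) x"
proof -
  have "evaluate (commutator_R bracket) (g * f) =
      evaluate (\<lambda>v. bracket (commutator_R bracket v) x) g"
    unfolding evaluate_mult
    using assms(2) by (intro evaluate_cong lie_monomial_acts(2)[OF assms(1)]) (metis free_monoid.collapse zero_free_monoid_def)
  then show ?thesis by (simp add: evaluate_bracket)
qed

lemma zero_notin_keys_lie_monomial: "lie_monomial br k f x \<Longrightarrow> 0 \<notin> Poly_Mapping.keys f"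
  using keys_lie_monomial[of br k f x 0] lie_monomial_pos[of br k f x] by auto

text \<open>The Dynkin-Specht-Wever identity. For a commutator, the two products contribute
  \<open>l\<close> and \<open>k\<close> times \<open>bracket x y\<close>, the second after
  antisymmetry.\<close>

lemma dynkin:
  assumes "lie_monomial bracket k f x"
  shows "evaluate (commutator_L bracket) f = scale (of_nat k) x"
    and "evaluate (commutator_R bracket) f = scale (of_nat k) x"
  using assms
proof induction
  case (letter x)
  { case 1 show ?case by simp next case 2 show ?case by simp }
next
  case (commutator k f x l g y)
  note zero = zero_notin_keys_lie_monomial[OF commutator(1)] zero_notin_keys_lie_monomial[OF commutator(2)]
  {
    case 1
    show ?case
      using commutator bracket_antisym[of y x]
      by (simp add: evaluate_linear evaluate_commutator_L_mult zero bracket_scale_right scale_left_distrib)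
  next
    case 2
    show ?case
      using commutator bracket_antisym[of y x]
      by (simp add: evaluate_linear evaluate_commutator_R_mult zero bracket_scale_left scale_left_distrib)
  }
qed

text \<open>In \<open>split_commutators\<close> of a product of Lie monomials \<open>f\<close> and \<open>g\<close> with values \<open>x\<close> and \<open>y\<close>, the
  splittings inside \<open>f\<close> contribute \<open>split_left y\<close>, those inside \<open>g\<close> contribute \<open>split_right x\<close>.  Both act
  on the value, so that by the Jacobi identity the difference of the two is again a commutator with
  \<open>split_commutators\<close>.\<close>

definition split_left :: "'g \<Rightarrow> 'g list \<Rightarrow> 'g" where
  "split_left z w = (\<Sum>p = 1..length w - 1.
     bracket (commutator_L bracket (take p w)) (bracket (commutator_R bracket (drop p w)) z))"

definition split_right :: "'g \<Rightarrow> 'g list \<Rightarrow> 'g" where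
  "split_right z w = (\<Sum>p = 1..length w - 1.
     bracket (bracket z (commutator_L bracket (take p w))) (commutator_R bracket (drop p w)))"

lemma split_left_eq: "split_left z w = split_right z w + bracket (split_commutators bracket w) z"
proof -
  have "bracket a (bracket b z) = bracket (bracket z a) b + bracket (bracket a b) z" for a b
    using bracket_antisym[of "bracket z a" b] bracket_antisym[of a z]
    by (simp add: bracket_bracket[of a b z] bracket_minus_right)
  then show ?thesis
    by (simp add: split_left_def split_right_def split_commutators_def bracket_sum_left sum.distrib)
qed

text \<open>The three terms collect the cuts inside \<open>u\<close>, between \<open>u\<close> and
  \<open>v\<close>, and inside \<open>v\<close>.\<close>

lemma split_commutators_append:
  assumes "u \<noteq> []" "v \<noteq> []"
  shows "split_commutators bracket (u @ v) =
    (\<Sum>p = 1..length u - 1. bracket (commutator_L bracket (take p u)) (commutator_R bracket (drop p u @ v))) +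
    bracket (commutator_L bracket u) (commutator_R bracket v) +
    (\<Sum>p = 1..length v - 1. bracket (commutator_L bracket (u @ take p v)) (commutator_R bracket (drop p v)))"
proof -
  let ?F = "\<lambda>p. bracket (commutator_L bracket (take p (u @ v))) (commutator_R bracket (drop p (u @ v)))"
  \<comment> \<open>Writing both lengths as successors removes the truncated subtractions from the
    index ranges.\<close>
  obtain i j where len: "length u = Suc i" "length v = Suc j"
    using assms by (metis length_0_conv not0_implies_Suc)
  have "{1..length (u @ v) - 1} = {1..length u - 1} \<union> {length u} \<union> (+) (length u) ` {1..length v - 1}"
    by (simp only: image_add_atLeastAtMost length_append len) auto
  then have "split_commutators bracket (u @ v) =
      sum ?F ({1..length u - 1} \<union> {length u} \<union> (+) (length u) ` {1..length v - 1})"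
    by (simp only: split_commutators_def)
  also have "\<dots> = sum ?F {1..length u - 1} + ?F (length u) + sum ?F ((+) (length u) ` {1..length v - 1})"
    using len by (subst sum.union_disjoint; force simp: sum.union_disjoint)
  also have "sum ?F ((+) (length u) ` {1..length v - 1}) = (\<Sum>p = 1..length v - 1. ?F (length u + p))"
    by (subst sum.reindex) simp_all
  also have "sum ?F {1..length u - 1} = (\<Sum>p = 1..length u - 1.
      bracket (commutator_L bracket (take p u)) (commutator_R bracket (drop p u @ v)))"
    by (rule sum.cong) auto
  finally show ?thesis by simp
qed

text \<open>A cut inside one factor leaves the other factor whole, and it acts by bracketing with
  its value. The cut between the factors contributes \<open>k * l\<close> by the Dynkin identity
  applied to each.\<close>

lemma evaluate_split_commutators_mult:
  assumes f: "lie_monomial bracket k f x" and g: "lie_monomial bracket l g y"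
  shows "evaluate (split_commutators bracket) (f * g) =
    evaluate (split_left y) f + scale (of_nat (k * l)) (bracket x y) + evaluate (split_right x) g"
proof -
  let ?L = "commutator_L bracket" and ?R = "commutator_R bracket"
  let ?A = "\<lambda>u v. \<Sum>p = 1..length u - 1. bracket (?L (take p u)) (?R (drop p u @ v))"
  let ?T = "\<lambda>u v. \<Sum>p = 1..length v - 1. bracket (?L (u @ take p v)) (?R (drop p v))"
  have ne: "letters w \<noteq> []" if "w \<in> Poly_Mapping.keys f \<or> w \<in> Poly_Mapping.keys g" for w
    using that keys_lie_monomial[OF f] keys_lie_monomial[OF g] lie_monomial_pos[OF f] lie_monomial_pos[OF g]
    by fastforce
  have "evaluate (split_commutators bracket) (f * g) =
      evaluate (\<lambda>u. evaluate (\<lambda>v. ?A u v + bracket (?L u) (?R v) + ?T u v) g) f"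
    unfolding evaluate_mult by (intro evaluate_cong split_commutators_append ne) auto
  also have "\<dots> = evaluate (\<lambda>u. evaluate (?A u) g) f +
      evaluate (\<lambda>u. evaluate (\<lambda>v. bracket (?L u) (?R v)) g) f +
      evaluate (\<lambda>v. evaluate (\<lambda>u. ?T u v) f) g"
    by (simp only: evaluate_fun evaluate_swap[of ?T])
  also have "evaluate (\<lambda>u. evaluate (?A u) g) f = evaluate (split_left y) f"
  proof (rule evaluate_cong)
    fix w
    show "evaluate (?A (letters w)) g = split_left y (letters w)"
      unfolding split_left_def evaluate_fun
      by (rule sum.cong) (auto simp: evaluate_bracket lie_monomial_acts(2)[OF g])
  qed
  also have "evaluate (\<lambda>v. evaluate (\<lambda>u. ?T u v) f) g = evaluate (split_right x) g"
  proof (rule evaluate_cong)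
    fix w
    show "evaluate (\<lambda>u. ?T u (letters w)) f = split_right x (letters w)"
      unfolding split_right_def evaluate_fun
    proof (rule sum.cong[OF refl])
      fix p assume "p \<in> {1..length (letters w) - 1}"
      then have "take p (letters w) \<noteq> []" by auto
      then show "evaluate (\<lambda>u. bracket (?L (u @ take p (letters w))) (?R (drop p (letters w)))) f =
          bracket (bracket x (?L (take p (letters w)))) (?R (drop p (letters w)))"
        by (simp add: evaluate_bracket lie_monomial_acts(1)[OF f])
    qed
  qed
  also have "evaluate (\<lambda>u. evaluate (\<lambda>v. bracket (?L u) (?R v)) g) f = scale (of_nat (k * l)) (bracket x y)"
    by (simp add: evaluate_bracket evaluate_fun(3) dynkin[OF f] dynkin[OF g] bracket_scale_left
        bracket_scale_right mult.commute)
  finally show ?thesis .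
qed

text \<open>In \<open>f * g - g * f\<close> the differences of \<open>split_left\<close> and
  \<open>split_right\<close> reduce by \<open>split_left_eq\<close> to the induction hypotheses,
  giving \<open>k * (k - 1)\<close> and \<open>l * (l - 1)\<close>. The middle cuts add
  \<open>k * l\<close> twice, and the total is \<open>(k + l) * (k + l - 1)\<close>.\<close>

lemma evaluate_split_commutators:
  assumes "lie_monomial bracket k f x"
  shows "evaluate (split_commutators bracket) f = scale (of_nat (k * (k - 1))) x"
  using assms
proof induction
  case (letter x)
  show ?case by (simp add: split_commutators_def)
next
  case (commutator k f x l g y)
  have left: "evaluate (split_left z) h = evaluate (split_right z) h + bracket (evaluate (split_commutators bracket) h) z" for z h
    unfolding split_left_eq[abs_def] by (simp add: evaluate_fun evaluate_bracket)
  have "(k + l) * (k + l - 1) = k * (k - 1) + l * (l - 1) + k * l + l * k"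
    using lie_monomial_pos[OF commutator(1)] lie_monomial_pos[OF commutator(2)]
    by (auto simp: gr0_conv_Suc algebra_simps)
  then have "scale (of_nat ((k + l) * (k + l - 1))) (bracket x y) = scale (of_nat (k * (k - 1))) (bracket x y) +
     scale (of_nat (l * (l - 1))) (bracket x y) + scale (of_nat (k * l)) (bracket x y) + scale (of_nat (l * k)) (bracket x y)"
    by (simp only: of_nat_add scale_left_distrib)
  then show ?case
    using commutator bracket_antisym[of y x]
    by (simp add: evaluate_linear evaluate_split_commutators_mult[OF commutator(1,2)]
      evaluate_split_commutators_mult[OF commutator(2,1)] left bracket_scale_left del: of_nat_mult)
qed

end

section \<open>Weight on the tensor algebra, invertible integers, and place permutations\<close>

lemma weight_tensor_null:
  assumes "f \<in> tensor_null scale"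
  shows "weight f \<in> tensor_null scale"
  using assms unfolding tensor_null_eq_two_sided
proof (induction rule: two_sided_induct)
  case (gen u g v)
  \<comment> \<open>Linear relators are homogeneous of degree 1, so \<open>weight\<close> merely
    rescales each generator of the ideal.\<close>
  have "homogeneous (length u + 1 + length v) (word u * g * word v)"
    by (intro homogeneous_mult homogeneous_word homogeneous_linear_relators[OF gen])
  then show ?case
    by (simp add: weight_homogeneous two_sided_closed two_sided_mult two_sided_base gen)
qed (simp_all add: weight_linear two_sided_closed)

lemma contains_rat_unit:
  assumes "contains_rat TYPE('k::comm_ring_1)" "n > 0"
  shows "(of_nat n :: 'k) dvd 1"
proof -
  obtain q :: "rat \<Rightarrow> 'k" where q: "q 1 = 1" "\<And>x y. q (x + y) = q x + q y" "\<And>x y. q (x * y) = q x * q y"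
    using assms(1) unfolding contains_rat_def by blast
  have "q 0 = 0" using q(2)[of 0 0] by simp
  then have nat: "q (of_nat m) = of_nat m" for m
    by (induction m) (simp_all add: q)
  have "1 = q (of_nat n * (1 / of_nat n))" using assms(2) q(1) by simp
  also have "\<dots> = of_nat n * q (1 / of_nat n)" by (simp only: q(3) nat)
  finally show ?thesis by (rule dvdI)
qed

text \<open>Unshuffling the positions \<open>[0..<n]\<close> yields permutations fixed once for all
  words of length \<open>n\<close>. Through them, closure of a submodule under place permutations
  implies closure under \<open>adams\<close>.\<close>

lemma adams_eq_sum_permutations:
  obtains \<sigma>s where "\<And>\<sigma>. \<sigma> \<in> set \<sigma>s \<Longrightarrow> \<sigma> permutes {..<n}"
    and "\<And>f :: 'g free_monoid \<Rightarrow>\<^sub>0 'k::comm_ring_1. homogeneous n f \<Longrightarrow> adams f = (\<Sum>\<sigma>\<leftarrow>\<sigma>s. fa_permute n \<sigma> f)"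
proof -
  have "\<exists>\<sigma>. \<sigma> permutes {..<n} \<and> permute_list \<sigma> [0..<n] = fst u @ snd u" if "u \<in> set (unshuffles [0..<n])" for u
    using mset_eq_permutation[OF mset_unshuffles[OF that]] by auto
  then obtain \<sigma> where \<sigma>: "\<And>u. u \<in> set (unshuffles [0..<n]) \<Longrightarrow>
      \<sigma> u permutes {..<n} \<and> permute_list (\<sigma> u) [0..<n] = fst u @ snd u"
    by metis
  let ?\<sigma>s = "map \<sigma> (unshuffles [0..<n])"
  have word: "adams (word xs :: 'g free_monoid \<Rightarrow>\<^sub>0 'k) = (\<Sum>\<sigma>\<leftarrow>?\<sigma>s. fa_permute n \<sigma> (word xs))"
    if "length xs = n" for xs
  proof -
    \<comment> \<open>A word is the image of its list of positions, and unshuffling commutes with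
      \<open>map\<close>.\<close>
    have xs: "xs = map ((!) xs) [0..<n]" using that map_nth by metis
    have "adams (word xs :: 'g free_monoid \<Rightarrow>\<^sub>0 'k) = (\<Sum>u\<leftarrow>unshuffles xs. word (fst u @ snd u))"
      by (simp add: adams_word case_prod_unfold)
    also have "\<dots> = (\<Sum>u\<leftarrow>unshuffles [0..<n]. word (map ((!) xs) (fst u @ snd u)))"
      by (subst xs) (simp add: unshuffles_map o_def)
    also have "\<dots> = (\<Sum>u\<leftarrow>unshuffles [0..<n]. fa_permute n (\<sigma> u) (word xs))"
    proof (intro arg_cong[where f = sum_list] map_cong refl)
      fix u assume u: "u \<in> set (unshuffles [0..<n])"
      have "map ((!) xs) (fst u @ snd u) = map ((!) xs) (permute_list (\<sigma> u) [0..<n])"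
        using \<sigma>[OF u] by simp
      also have "\<dots> = permute_list (\<sigma> u) xs"
        using permute_list_map[of "\<sigma> u" "[0..<n]" "(!) xs"] \<sigma>[OF u] by (simp flip: xs)
      finally show "word (map ((!) xs) (fst u @ snd u)) = fa_permute n (\<sigma> u) (word xs)"
        using that by (simp add: fa_permute_word permute_word_def)
    qed
    finally show ?thesis by (simp add: o_def)
  qed
  have sum: "h (sum g S) = (\<Sum>i\<in>S. h (g i))" if "\<And>f g. h (f + g) = h f + h g"
    for h :: "('g free_monoid \<Rightarrow>\<^sub>0 'k) \<Rightarrow> ('g free_monoid \<Rightarrow>\<^sub>0 'k)" and g and S :: "'g free_monoid set"
  proof -
    have "h 0 = 0" using that[of 0 0] by simp
    then show ?thesis by (induction S rule: infinite_finite_induct) (simp_all add: that)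
  qed
  have "adams f = (\<Sum>\<sigma>\<leftarrow>?\<sigma>s. fa_permute n \<sigma> f)" if "homogeneous n f" for f :: "'g free_monoid \<Rightarrow>\<^sub>0 'k"
  proof -
    let ?h = "\<lambda>f :: 'g free_monoid \<Rightarrow>\<^sub>0 'k. \<Sum>\<sigma>\<leftarrow>?\<sigma>s. fa_permute n \<sigma> f"
    have "(\<Sum>\<sigma>\<leftarrow>\<tau>s. fa_permute n \<sigma> (pm_scale c f)) = pm_scale c (\<Sum>\<sigma>\<leftarrow>\<tau>s. fa_permute n \<sigma> f)"
      for \<tau>s c and f :: "'g free_monoid \<Rightarrow>\<^sub>0 'k"
      by (induction \<tau>s)
        (simp_all add: pm.scale_right_distrib fa_permute_fa_scale[unfolded fa_scale_eq_pm_scale])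
    then have h: "?h (f + g) = ?h f + ?h g" "?h (pm_scale c f) = pm_scale c (?h f)" for f g c
      by (simp_all only: fa_permute_add sum_list_addf)
    have f: "f = (\<Sum>w\<in>Poly_Mapping.keys f. pm_scale (Poly_Mapping.lookup f w) (word (letters w)))"
      by (subst fa_eq_lin_ext) (simp add: lin_ext_def)
    have "adams (\<Sum>w\<in>Poly_Mapping.keys f. pm_scale (Poly_Mapping.lookup f w) (word (letters w))) =
        ?h (\<Sum>w\<in>Poly_Mapping.keys f. pm_scale (Poly_Mapping.lookup f w) (word (letters w)))"
      unfolding sum[of adams, OF linear_maps_add(5)] sum[of ?h, OF h(1)] linear_maps_scale h(2)
      using that by (intro sum.cong refl arg_cong[where f = "pm_scale _"] word) (simp add: homogeneous_def)
    then show ?thesis by (simp flip: f)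
  qed
  then show ?thesis using \<sigma> by (intro that[of ?\<sigma>s]) auto
qed


section \<open>The kernel of the projection to the enveloping algebra\<close>

abbreviation tensor_coset ::
    "('k::comm_ring_1 \<Rightarrow> 'g::ab_group_add \<Rightarrow> 'g) \<Rightarrow> ('g free_monoid \<Rightarrow>\<^sub>0 'k) \<Rightarrow> ('g free_monoid \<Rightarrow>\<^sub>0 'k) set" where
  "tensor_coset scale f \<equiv> tensor_null scale +>\<^bsub>free_algebra\<^esub> f"

lemma zero_tensor_algebra: "\<zero>\<^bsub>tensor_algebra scale\<^esub> = tensor_coset scale 0"
  by (simp add: tensor_algebra_def FactRing_def coset_free_algebra)

lemma tensor_coset_in_carrier: "tensor_coset scale f \<in> carrier (tensor_algebra scale)"
  by (simp add: tensor_coset_ops(4))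

lemma tensor_coset_uminus: "\<ominus>\<^bsub>tensor_algebra scale\<^esub> tensor_coset scale f = tensor_coset scale (- f)"
proof -
  interpret T: ring "tensor_algebra scale" by (rule ring_tensor_algebra)
  show ?thesis
    by (rule T.minus_equality) (simp_all add: tensor_coset_in_carrier tensor_coset_ops(1) zero_tensor_algebra)
qed

lemma tensor_coset_minus:
  "tensor_coset scale f \<ominus>\<^bsub>tensor_algebra scale\<^esub> tensor_coset scale g = tensor_coset scale (f - g)"
  by (simp add: a_minus_def tensor_coset_uminus tensor_coset_ops(1))

lemma enveloping_ideal_generator:
  "(pure_tensor scale [x] \<otimes>\<^bsub>tensor_algebra scale\<^esub> pure_tensor scale [y]
     \<ominus>\<^bsub>tensor_algebra scale\<^esub> pure_tensor scale [y] \<otimes>\<^bsub>tensor_algebra scale\<^esub> pure_tensor scale [x])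
     \<ominus>\<^bsub>tensor_algebra scale\<^esub> pure_tensor scale [br x y] =
   tensor_coset scale (word [x] * word [y] - word [y] * word [x] - word [br x y])"
  by (simp add: pure_tensor_def tensor_coset_ops(2) tensor_coset_minus)

text \<open>Being an ideal that contains the defining relators, this image bounds the enveloping
  ideal from above.\<close>

lemma ideal_env_null: "ideal (tensor_coset scale ` env_null scale br) (tensor_algebra scale)"
proof -
  interpret T: ring "tensor_algebra scale" by (rule ring_tensor_algebra)
  have "subgroup (tensor_coset scale ` env_null scale br) (add_monoid (tensor_algebra scale))"
  proof (rule T.add.subgroupI)
    show "tensor_coset scale ` env_null scale br \<subseteq> carrier (tensor_algebra scale)"
      by (auto simp: tensor_coset_in_carrier)
    show "tensor_coset scale ` env_null scale br \<noteq> {}"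
      using two_sided_closed(1) by (auto simp: env_null_def)
  next
    fix A assume "A \<in> tensor_coset scale ` env_null scale br"
    then show "\<ominus>\<^bsub>tensor_algebra scale\<^esub> A \<in> tensor_coset scale ` env_null scale br"
      by (auto simp: tensor_coset_uminus env_null_def two_sided_closed)
  next
    fix A B assume "A \<in> tensor_coset scale ` env_null scale br" "B \<in> tensor_coset scale ` env_null scale br"
    then show "A \<oplus>\<^bsub>tensor_algebra scale\<^esub> B \<in> tensor_coset scale ` env_null scale br"
      by (auto simp: tensor_coset_ops(1) env_null_def two_sided_closed)
  qed
  then show ?thesis
    by (rule idealI[OF ring_tensor_algebra])
      (auto simp: tensor_coset_ops(2,4) env_null_def two_sided_mult)
qed

text \<open>One direction is minimality of the generated ideal, the other an induction over the
  generators of \<open>env_null\<close>.\<close>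

lemma tensor_coset_in_enveloping_ideal:
  "tensor_coset scale f \<in> enveloping_ideal scale br \<longleftrightarrow> f \<in> env_null scale br"
proof
  interpret T: ring "tensor_algebra scale" by (rule ring_tensor_algebra)
  have "enveloping_ideal scale br \<subseteq> tensor_coset scale ` env_null scale br"
    unfolding enveloping_ideal_def Let_def enveloping_ideal_generator
    by (intro T.genideal_minimal ideal_env_null) (auto intro!: imageI env_null_letter)
  moreover assume "tensor_coset scale f \<in> enveloping_ideal scale br"
  ultimately obtain h where h: "h \<in> env_null scale br" "tensor_coset scale f = tensor_coset scale h" by blast
  \<comment> \<open>Equal cosets determine \<open>f\<close> only up to \<open>tensor_null\<close>,
    which is contained in \<open>env_null\<close>.\<close>
  then have "f - h \<in> env_null scale br"
    using tensor_null_subset_env_null by (auto simp: tensor_coset_ops(5))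
  with h(1) have "(f - h) + h \<in> env_null scale br" unfolding env_null_def by (intro two_sided_closed(2))
  then show "f \<in> env_null scale br" by simp
next
  interpret T: ring "tensor_algebra scale" by (rule ring_tensor_algebra)
  interpret I: ideal "enveloping_ideal scale br" "tensor_algebra scale" by (rule ideal_enveloping_ideal)
  note ops = tensor_coset_ops[of scale]
  assume "f \<in> env_null scale br"
  then show "tensor_coset scale f \<in> enveloping_ideal scale br"
    unfolding env_null_def
  proof (induction rule: two_sided_induct)
    case (gen u g v)
    have "tensor_coset scale g \<in> enveloping_ideal scale br"
    \<comment> \<open>Linear relators already vanish in the tensor algebra; bracket relators
      generate the enveloping ideal.\<close>
    proof (cases "g \<in> linear_relators scale")
      case True
      then have "g \<in> tensor_null scale" by (simp add: tensor_null_eq_two_sided two_sided_base)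
      then have "tensor_coset scale g = \<zero>\<^bsub>tensor_algebra scale\<^esub>"
        by (simp add: zero_tensor_algebra tensor_coset_ops(5))
      then show ?thesis by simp
    next
      case False
      then obtain x y where "g = word [x] * word [y] - word [y] * word [x] - word [br x y]"
        using gen by (auto simp: bracket_relators_def)
      then show ?thesis
        unfolding enveloping_ideal_def Let_def enveloping_ideal_generator
        by (intro subsetD[OF T.genideal_self]) (auto simp: tensor_coset_in_carrier)
    qed
    then have "tensor_coset scale (word u) \<otimes>\<^bsub>tensor_algebra scale\<^esub> tensor_coset scale g
        \<otimes>\<^bsub>tensor_algebra scale\<^esub> tensor_coset scale (word v) \<in> enveloping_ideal scale br"
      by (intro I.I_l_closed I.I_r_closed tensor_coset_in_carrier)
    then show ?case by (simp add: ops(2))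
  next
    case zero
    then show ?case by (simp flip: zero_tensor_algebra)
  next
    case (add f g)
    from I.a_closed[OF this] show ?case by (simp add: ops(1))
  next
    case (scale c f)
    \<comment> \<open>A ring ideal absorbs scalars because scaling by \<open>c\<close> is
      multiplication by \<open>single 0 c\<close>.\<close>
    from I.I_l_closed[OF this tensor_coset_in_carrier[of scale "Poly_Mapping.single 0 c"]]
    show ?case by (simp add: ops(2) pm_scale_def mult_map_scale_conv_mult)
  qed
qed

lemma env_proj_tensor_coset_eq_iff:
  "env_proj scale br (tensor_coset scale f) = env_proj scale br (tensor_coset scale g) \<longleftrightarrow>
    f - g \<in> env_null scale br"
  unfolding env_proj_def
  using ring.quotient_eq_iff_same_a_r_cos[OF ring_tensor_algebra ideal_enveloping_ideal
      tensor_coset_in_carrier tensor_coset_in_carrier, of scale f g br]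
  by (simp add: tensor_coset_minus tensor_coset_in_enveloping_ideal)

lemma env_proj_add_pow:
  "[m] \<cdot>\<^bsub>enveloping_algebra scale br\<^esub> env_proj scale br (tensor_coset scale f) =
    env_proj scale br (tensor_coset scale (pm_scale (of_nat m) f))"
proof -
  interpret T: ring "tensor_algebra scale" by (rule ring_tensor_algebra)
  interpret U: ring "enveloping_algebra scale br" by (rule ring_enveloping_algebra)
  interpret h: ring_hom_ring "tensor_algebra scale" "enveloping_algebra scale br" "env_proj scale br"
    using env_proj_ring_hom[of scale br] by (intro ring_hom_ringI2 ring_tensor_algebra ring_enveloping_algebra)
  show ?thesis
  proof (induction m)
    case 0
    show ?case using h.hom_zero by (simp add: zero_tensor_algebra)
  next
    case (Suc m)
    have "env_proj scale br (tensor_coset scale (pm_scale (of_nat (Suc m)) f)) =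
        env_proj scale br (tensor_coset scale (pm_scale (of_nat m) f)) \<oplus>\<^bsub>enveloping_algebra scale br\<^esub>
        env_proj scale br (tensor_coset scale f)"
      by (simp add: h.hom_add[OF tensor_coset_in_carrier tensor_coset_in_carrier, symmetric]
          tensor_coset_ops(1) pm.scale_left_distrib add.commute)
    then show ?case by (simp add: Suc.IH)
  qed
qed

lemma finsum_pure_tensor:
  "finite A \<Longrightarrow> (\<Oplus>\<^bsub>tensor_algebra scale\<^esub>l\<in>A. pure_tensor scale (xs l)) = tensor_coset scale (\<Sum>l\<in>A. word (xs l))"
proof (induction A rule: finite_induct)
  case empty
  interpret T: ring "tensor_algebra scale" by (rule ring_tensor_algebra)
  show ?case by (simp add: zero_tensor_algebra)
next
  case (insert l A)
  interpret T: ring "tensor_algebra scale" by (rule ring_tensor_algebra)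
  show ?case
    using insert by (simp add: T.finsum_insert pure_tensor_in_carrier Pi_def)
      (simp add: pure_tensor_def tensor_coset_ops(1))
qed

section \<open>Combinations of Lie monomials in the enveloping algebra, and conclusion\<close>

lemma lie_monomial_closed_primitives:
  "lie_closed_primitives {f. \<exists>k x. lie_monomial br k f x}"
  by unfold_locales (auto intro: primitive_lie_monomial lie_monomial.commutator)

text \<open>For a Lie monomial of degree \<open>k\<close> with value \<open>x\<close>, both terms
  equal \<open>k * (k - 1)\<close> times the letter \<open>x\<close> modulo \<open>env_null\<close>.
  The extension to combinations uses the linear relators, as forming a one-letter word is linear
  only modulo these.\<close>

lemma (in lie_algebra) weight_filt_1:
  assumes "f \<in> lie_closed_primitives.filt {f. \<exists>k x. lie_monomial bracket k f x} 1"
  shows "weight f - word [evaluate (split_commutators bracket) f] \<in> env_null scale bracket"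
proof -
  interpret M: lie_closed_primitives "{f. \<exists>k x. lie_monomial bracket k f x}"
    by (rule lie_monomial_closed_primitives)
  let ?S = "evaluate (split_commutators bracket)"
  note closed = two_sided_closed[where G = "linear_relators scale \<union> bracket_relators bracket", folded env_null_def]
  have letter_add: "word [x + y] - word [x] - word [y] \<in> env_null scale bracket" for x y
    by (rule env_null_letter)
  have letter_scale: "word [scale c x] - pm_scale c (word [x]) \<in> env_null scale bracket" for c x
    by (rule env_null_letter)
  from assms show ?thesis
  proof (induction rule: M.filt_induct)
    case (prod ls)
    then obtain l where ls: "ls = [l]" by (cases ls) (auto simp: le_Suc_eq)
    with prod obtain k x where l: "lie_monomial bracket k l x" by auto
    have "pm_scale (of_nat (k * (k - 1))) (l - word [x])
        - (word [scale (of_nat (k * (k - 1))) x] - pm_scale (of_nat (k * (k - 1))) (word [x])) \<in> env_null scale bracket"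
      by (intro closed letter_scale lie_monomial_env_null[OF l])
    then show ?case
      by (simp only: ls prod_list.Cons prod_list.Nil mult_1_right evaluate_split_commutators[OF l]
          weight_homogeneous[OF homogeneous_lie_monomial[OF l]] pm.scale_right_diff_distrib) simp
  next
    case zero
    \<comment> \<open>The one-letter word on the zero of the Lie algebra is not zero in the free
      algebra; it is the negative of a relator.\<close>
    show ?case using letter_add[of 0 0] by (simp add: weight_linear evaluate_linear)
  next
    case (add f g)
    have "(weight f - word [?S f]) + (weight g - word [?S g]) - (word [?S f + ?S g] - word [?S f] - word [?S g])
        \<in> env_null scale bracket"
      by (intro closed add letter_add)
    then show ?case by (simp add: weight_linear evaluate_linear algebra_simps)
  next
    case (scale c f)
    have "pm_scale c (weight f - word [?S f]) - (word [scale c (?S f)] - pm_scale c (word [?S f])) \<in> env_null scale bracket"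
      by (intro closed scale letter_scale)
    then show ?case by (simp add: weight_linear evaluate_linear pm.scale_right_diff_distrib)
  qed
qed

lemma tensor_coset_sum_list:
  assumes "subgroup W (add_monoid (tensor_algebra scale))" "\<And>f. f \<in> set fs \<Longrightarrow> tensor_coset scale f \<in> W"
  shows "tensor_coset scale (sum_list fs) \<in> W"
  using assms(2)
proof (induction fs)
  case Nil
  then show ?case using subgroup.one_closed[OF assms(1)] by (simp add: zero_tensor_algebra)
next
  case (Cons f fs)
  then show ?case using subgroup.m_closed[OF assms(1), of "tensor_coset scale f" "tensor_coset scale (sum_list fs)"]
    by (simp add: tensor_coset_ops(1))
qed

theorem proposition3p3:
  fixes scale :: "'k::comm_ring_1 \<Rightarrow> 'g::ab_group_add \<Rightarrow> 'g"
    and bracket :: "'g \<Rightarrow> 'g \<Rightarrow> 'g"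
    and n :: nat
    and W :: "('g free_monoid \<Rightarrow>\<^sub>0 'k) set set"
    and P :: "('g free_monoid \<Rightarrow>\<^sub>0 'k) set"
    and a :: "nat \<Rightarrow> 'l \<Rightarrow> 'g"
    and \<Lambda> :: "'l set"
  assumes "contains_rat TYPE('k)"
    and "lie_algebra scale bracket"
    and "n \<ge> 1"
    and "submodule W scalar_ring (tensor_algebra scale)"
    and "W \<subseteq> tensor_power scale n"
    and "\<And>\<sigma> A. \<sigma> permutes {..<n} \<Longrightarrow> A \<in> W \<Longrightarrow> tensor_permute scale n \<sigma> A \<in> W"
    and "inj_on (env_proj scale bracket) W"
    and "finite \<Lambda>"
    and "P = (\<Oplus>\<^bsub>tensor_algebra scale\<^esub>l\<in>\<Lambda>. pure_tensor scale (map (\<lambda>i. a i l) [1..<n+1]))"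
    and "P \<in> W"
    and "env_proj scale bracket P \<in> range (env_incl scale bracket)"
  shows "[(n * (n - 1))] \<cdot>\<^bsub>enveloping_algebra scale bracket\<^esub> env_proj scale bracket P =
         env_incl scale bracket
           (\<Sum>l\<in>\<Lambda>. \<Sum>p = 1..n-1.
              bracket (commutator_L bracket (map (\<lambda>i. a i l) [1..<p+1]))
                      (commutator_R bracket (map (\<lambda>i. a i l) [p+1..<n+1])))"
proof -
  interpret lie_algebra scale bracket by fact
  interpret W: submodule W scalar_ring "tensor_algebra scale" by fact
  interpret M: lie_closed_primitives "{f. \<exists>k x. lie_monomial bracket k f x} :: ('g free_monoid \<Rightarrow>\<^sub>0 'k) set"
    by (rule lie_monomial_closed_primitives)
  let ?J = "env_null scale bracket" and ?S = "evaluate (split_commutators bracket)"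
  note closed = two_sided_closed[where G = "linear_relators scale \<union> bracket_relators bracket", folded env_null_def]
  define xs where "xs l = map (\<lambda>i. a i l) [1..<n + 1]" for l
  define f :: "'g free_monoid \<Rightarrow>\<^sub>0 'k" where "f = (\<Sum>l\<in>\<Lambda>. word (xs l))"
  have len: "length (xs l) = n" for l by (simp add: xs_def)
  have P: "P = tensor_coset scale f"
    unfolding assms(9) f_def xs_def by (rule finsum_pure_tensor) fact
  have hom: "homogeneous n f"
    unfolding f_def by (intro homogeneous_sum) (metis homogeneous_word len)
  obtain x where "env_proj scale bracket P = env_incl scale bracket x" using assms(11) by blast
  then have x: "f - word [x] \<in> ?J"
    by (simp add: P env_incl_def pure_tensor_def env_proj_tensor_coset_eq_iff)
  \<comment> \<open>Since \<open>adams\<close> preserves \<open>?J\<close> and doubles the letter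
    \<open>x\<close>, it doubles \<open>f\<close> modulo \<open>?J\<close>.\<close>
  have "adams (f - word [x]) - pm_scale 2 (f - word [x]) \<in> ?J"
    unfolding env_null_def
    by (intro two_sided_closed adams_two_sided x[unfolded env_null_def])
      (auto intro: primitive_linear_relators primitive_bracket_relators)
  moreover have "pm_scale 2 (word [x]) = adams (word [x] :: 'g free_monoid \<Rightarrow>\<^sub>0 'k)"
    using pm.scale_left_distrib[of 1 1 "word [x]"] by (simp add: adams_primitive primitive_letter)
  ultimately have "adams f - pm_scale 2 f \<in> ?J"
    by (simp add: linear_maps_diff pm.scale_right_diff_distrib)
  then have "env_proj scale bracket (tensor_coset scale (adams f)) = env_proj scale bracket (tensor_coset scale (pm_scale 2 f))"
    by (simp add: env_proj_tensor_coset_eq_iff)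
  moreover have "tensor_coset scale (adams f) \<in> W"
  proof -
    obtain \<sigma>s where \<sigma>s: "\<And>\<sigma>. \<sigma> \<in> set \<sigma>s \<Longrightarrow> \<sigma> permutes {..<n}" "adams f = (\<Sum>\<sigma>\<leftarrow>\<sigma>s. fa_permute n \<sigma> f)"
      using adams_eq_sum_permutations[of n] hom by metis
    have "tensor_coset scale (fa_permute n \<sigma> f) \<in> W" if "\<sigma> \<in> set \<sigma>s" for \<sigma>
      using assms(6)[OF \<sigma>s(1)[OF that] assms(10)] tensor_permute_coset[OF \<sigma>s(1)[OF that], of scale f]
      by (simp add: P)
    then show ?thesis
      unfolding \<sigma>s(2) by (intro tensor_coset_sum_list W.subgroup_axioms) auto
  qed
  moreover have "tensor_coset scale (pm_scale 2 f) \<in> W"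
    using W.smult_closed[OF _ assms(10), of 2]
    by (simp add: P tensor_coset_ops(3) fa_scale_eq_pm_scale)
  \<comment> \<open>Injectivity on \<open>W\<close> lifts the eigenvector equation from the
    enveloping algebra to the tensor algebra.\<close>
  ultimately have "tensor_coset scale (adams f) = tensor_coset scale (pm_scale 2 f)"
    using assms(7) by (auto dest: inj_onD)
  then have eigen: "adams f - pm_scale 2 f \<in> two_sided (linear_relators scale)"
    by (simp add: tensor_coset_ops(5) flip: tensor_null_eq_two_sided)
  have filt: "f \<in> M.filt n"
  proof -
    have "word (xs l) \<in> M.filt n" for l
      unfolding word_eq_prod_list[of "xs l"]
      by (rule M.filt_closed(5)) (use assms(3) len[of l] in \<open>auto intro: lie_monomial.letter\<close>)
    then show ?thesis unfolding f_def M.filt_def by (intro pm.span_sum)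
  qed
  obtain m where m: "n = Suc m" using assms(3) by (cases n) auto
  \<comment> \<open>The positive integer \<open>2 ^ (m + 2) - 2\<close> is invertible because the
    base ring contains the rationals.\<close>
  have unit: "(2 ^ (m + 2) - 2 :: 'k) dvd 1" for m
  proof -
    have less: "(2::nat) < 2 ^ (m + 2)"
      using power_strict_increasing[of 1 "m + 2" "2::nat"] by simp
    then have "(of_nat (2 ^ (m + 2) - 2) :: 'k) dvd 1"
      by (intro contains_rat_unit assms(1)) simp
    then show ?thesis using less by (simp add: of_nat_diff)
  qed
  have "\<exists>l\<in>M.filt 1. f - l \<in> tensor_null scale"
    unfolding tensor_null_eq_two_sided
    by (rule M.adams_eigenvector[OF primitive_linear_relators unit filt[unfolded m] eigen])
  then obtain l where l: "l \<in> M.filt 1" "f - l \<in> tensor_null scale" by blast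
  \<comment> \<open>Both \<open>?S\<close> and \<open>weight\<close> respect
    \<open>tensor_null\<close>, so \<open>f\<close> may be exchanged for the combination
    \<open>l\<close> of Lie monomials.\<close>
  have "?S f = ?S l"
    using evaluate_tensor_null[OF multilinear_split_commutators l(2)] by (simp add: evaluate_linear)
  moreover have "weight f - weight l \<in> ?J"
    using weight_tensor_null[OF l(2)] tensor_null_subset_env_null by (auto simp: weight_linear)
  from closed(2)[OF this weight_filt_1[OF l(1)]]
  have "weight f - word [?S l] \<in> ?J" by simp
  ultimately have "pm_scale (of_nat (n * (n - 1))) f - word [?S f] \<in> ?J"
    by (simp add: weight_homogeneous[OF hom])
  then have "[(n * (n - 1))] \<cdot>\<^bsub>enveloping_algebra scale bracket\<^esub> env_proj scale bracket P =
      env_incl scale bracket (?S f)"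
    unfolding P env_proj_add_pow env_incl_def pure_tensor_def
    by (simp only: env_proj_tensor_coset_eq_iff)
  also have "?S f = (\<Sum>l\<in>\<Lambda>. split_commutators bracket (xs l))"
    by (simp add: f_def evaluate_linear)
  also have "\<dots> = (\<Sum>l\<in>\<Lambda>. \<Sum>p = 1..n-1.
      bracket (commutator_L bracket (map (\<lambda>i. a i l) [1..<p+1]))
              (commutator_R bracket (map (\<lambda>i. a i l) [p+1..<n+1])))"
    unfolding split_commutators_def len
    by (intro sum.cong refl) (auto simp: xs_def take_map drop_map take_upt drop_upt simp del: upt_Suc)
  finally show ?thesis .
qed

end
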